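(* Let $Y_i$, $i\ge1$, be extended negatively orthant dependent (ENOD) random variables with common distribution $G\in\mathcal C$ on $[0,\infty)$ and finite mean $\mu_G$, and let $Z_i$, $i\ge1$, be ENOD random variables with common distribution $H$ on $[0,\infty)$ and finite mean $\mu_H$; let $\{Y_i\}$ be independent of $\{Z_i\}$. Let $c>0$ with $\mu_G<c\mu_H$, let $N(t)=\sum_{n=1}^\infty\mathbf 1_{\{\tau_n\le t\}}$ with $\tau_n=\sum_{i=1}^nZ_i$, and let $\lambda(t)=EN(t)$, $t\ge0$, with $\inf\{t:\lambda(t)>0\}=0$. Let $\tau$ be a nonnegative integer-valued random variable independent of $\{Y_i,Z_i,i\ge1\}$. Put $S_0=0$, $S_n=\sum_{i=1}^n(Y_i-cZ_i)$, and define the random-time ruin probability $$\psi(x;\tau)=P\Big(\sup_{0\le n\le N(\tau)}S_n>x\Big).$$ If $$P\big(N(\tau)>x\big)=o\big(\overline G(x)\big),\qquad x\to\infty,$$ then $$\psi(x;\tau)\sim E[\lambda(\tau)]\,\overline G(x),\qquad x\to\infty.$$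
   Context: For a distribution $G$, $\overline G=1-G$ is its tail (assumed positive everywhere when ratios of tails are taken). The consistently varying tailed class $\mathcal C$ consists of the distributions $G$ with $\lim_{y\downarrow1}\liminf_{x\to\infty}\overline G(xy)/\overline G(x)=1$. $g_1(x)\sim g_2(x)$ means $g_1(x)/g_2(x)\to1$ as $x\to\infty$. Random variables $X_i$, $i\ge1$, are ENOD if there is a constant $M>0$ such that for every $n\ge1$ and all real $x_1,\dots,x_n$, both $P\big(\bigcap_{i=1}^n\{X_i>x_i\}\big)\le M\prod_{i=1}^nP(X_i>x_i)$ and $P\big(\bigcap_{i=1}^n\{X_i\le x_i\}\big)\le M\prod_{i=1}^nP(X_i\le x_i)$. In the interpretation, $Y_i$ are claim sizes, $Z_i$ inter-arrival times, and $x$ the initial capital of an insurance company. *)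

theory Defs
  imports "HOL-Probability.Probability" "HOL-Library.Landau_Symbols"
begin

definition tail :: "real measure \<Rightarrow> real \<Rightarrow> real" where
  "tail G x = 1 - cdf G x"

definition consistently_varying :: "real measure \<Rightarrow> bool" where
  "consistently_varying G \<longleftrightarrow>
     (\<forall>x. tail G x > 0) \<and>
     ((\<lambda>y. Liminf at_top (\<lambda>x. ereal (tail G (x * y) / tail G x))) \<longlongrightarrow> 1) (at_right 1)"

text \<open>
  Sequences of random variables are indexed by the integers \<open>i \<ge> 1\<close>;
  the value at index 0 is never used.
\<close>

definition ENOD :: "'a measure \<Rightarrow> (nat \<Rightarrow> 'a \<Rightarrow> real) \<Rightarrow> bool" where
  "ENOD M X \<longleftrightarrow>
     (\<exists>K>0. \<forall>n\<ge>1. \<forall>x :: nat \<Rightarrow> real.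
        measure M {\<omega> \<in> space M. \<forall>i\<in>{1..n}. X i \<omega> > x i}
          \<le> K * (\<Prod>i=1..n. measure M {\<omega> \<in> space M. X i \<omega> > x i}) \<and>
        measure M {\<omega> \<in> space M. \<forall>i\<in>{1..n}. X i \<omega> \<le> x i}
          \<le> K * (\<Prod>i=1..n. measure M {\<omega> \<in> space M. X i \<omega> \<le> x i}))"

text \<open>
  Independence of two random elements with possibly different value types (unlike
  \<^const>\<open>prob_space.indep_var\<close>): the \<open>\<sigma>\<close>-algebras they generate are independent.
\<close>

definition indep_rv ::
  "'a measure \<Rightarrow> 'b measure \<Rightarrow> ('a \<Rightarrow> 'b) \<Rightarrow> 'c measure \<Rightarrow> ('a \<Rightarrow> 'c) \<Rightarrow> bool" where
  "indep_rv M S U T V \<longleftrightarrow>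
     prob_space.indep_set M (sets (vimage_algebra (space M) U S))
                            (sets (vimage_algebra (space M) V T))"

definition seq_space :: "(nat \<Rightarrow> real) measure" where
  "seq_space = (\<Pi>\<^sub>M i\<in>{1..}. borel)"

definition seq_rv :: "(nat \<Rightarrow> 'a \<Rightarrow> real) \<Rightarrow> 'a \<Rightarrow> nat \<Rightarrow> real" where
  "seq_rv X \<omega> = (\<lambda>i\<in>{1..}. X i \<omega>)"

definition arrival_time :: "(nat \<Rightarrow> 'a \<Rightarrow> real) \<Rightarrow> nat \<Rightarrow> 'a \<Rightarrow> real" where
  "arrival_time Z n \<omega> = (\<Sum>i=1..n. Z i \<omega>)"

text \<open>
  The counting process is extended-valued, since the series may diverge on a null set.
  The series is over \<open>n \<ge> 1\<close>, hence the shift by \<^const>\<open>Suc\<close>.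
\<close>

definition renewal_count :: "(nat \<Rightarrow> 'a \<Rightarrow> real) \<Rightarrow> real \<Rightarrow> 'a \<Rightarrow> ennreal" where
  "renewal_count Z t \<omega> = (\<Sum>n. indicator {..t} (arrival_time Z (Suc n) \<omega>))"

definition renewal_mean :: "'a measure \<Rightarrow> (nat \<Rightarrow> 'a \<Rightarrow> real) \<Rightarrow> real \<Rightarrow> ennreal" where
  "renewal_mean M Z t = (\<integral>\<^sup>+ \<omega>. renewal_count Z t \<omega> \<partial>M)"

definition net_loss ::
  "(nat \<Rightarrow> 'a \<Rightarrow> real) \<Rightarrow> (nat \<Rightarrow> 'a \<Rightarrow> real) \<Rightarrow> real \<Rightarrow> nat \<Rightarrow> 'a \<Rightarrow> real" where
  "net_loss Y Z c n \<omega> = (\<Sum>i=1..n. Y i \<omega> - c * Z i \<omega>)"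

definition ruin_prob ::
  "'a measure \<Rightarrow> (nat \<Rightarrow> 'a \<Rightarrow> real) \<Rightarrow> (nat \<Rightarrow> 'a \<Rightarrow> real) \<Rightarrow> real \<Rightarrow> ('a \<Rightarrow> nat) \<Rightarrow> real \<Rightarrow> real" where
  "ruin_prob M Y Z c \<tau> x =
     measure M {\<omega> \<in> space M.
       (SUP n\<in>{n :: nat. of_nat n \<le> renewal_count Z (real (\<tau> \<omega>)) \<omega>}.
          ereal (net_loss Y Z c n \<omega>)) > ereal x}"

end

theory Submission
  imports Defs
begin

text \<open>
  The tail \<open>tail G\<close> is so heavy that ruin is caused by a single large claim. Write \<open>T\<^sub>n\<close> for the
  sum of the first \<open>n\<close> claims and \<open>N\<close> for the number of arrivals up to the random time \<open>\<tau>\<close>.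
  For fixed \<open>n\<close>, the events \<open>T\<^sub>n > x\<close> and \<open>max Y\<^sub>i > x\<close> both have probability asymptotic to
  \<open>n * tail G x\<close>: two large claims among \<open>n\<close> cost a factor \<open>(tail G x)\<^sup>2\<close> by orthant dependence
  (\<open>pair_bound\<close>), and lowering the level from \<open>x\<close> to \<open>(1 - \<delta>) x\<close> is harmless by consistent
  variation. Since \<open>N\<close> is independent of the claims, summing over the values of \<open>N\<close> suggests the limit
  \<open>\<Sum>n n P(N = n) = E N\<close>, and \<open>E N = E \<lambda>(\<tau>)\<close> because \<open>\<tau>\<close> is independent of the arrivals.

  Ruin up to time \<open>\<tau>\<close> is squeezed between two events. It forces \<open>T\<^sub>N > x\<close>, since the claims and the
  premiums are nonnegative; and it is implied by \<open>N = n\<close> together with a premium income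
  \<open>c (Z\<^sub>1 + \<dots> + Z\<^sub>n) \<le> b\<close> and one of the first \<open>n\<close> claims exceeding \<open>x + b\<close>. For the second event the
  level \<open>x + b\<close> may be replaced by \<open>x\<close> asymptotically, and \<open>b \<rightarrow> \<infinity>\<close> afterwards
  (\<open>random_sum_tail_lower\<close>).

  The work is in the upper bound, where the limit has to be exchanged with the infinite sum over \<open>n\<close>
  (\<open>random_sum_tail_upper\<close>). The values \<open>n > x / B\<close> contribute at most \<open>P(N > x / B)\<close>, which is
  negligible by the hypothesis on \<open>N\<close>. For the others Tannery's theorem applies with the dominating
  sequence \<open>C n P(N = n)\<close>, thanks to the uniform bound \<open>P(T\<^sub>n > x) \<le> C n tail G x\<close> for all
  \<open>x \<ge> 4 \<mu> n\<close>, where \<open>\<mu>\<close> is the mean of \<open>G\<close> (\<open>uniform_sum_tail_bound\<close>). That bound comes from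
  truncating the claims at \<open>x / 2\<close> and from a Chernoff estimate, which survives the dependence because
  \<open>y \<mapsto> exp (h min(y, b))\<close> is increasing, hence a mixture of indicators of upper half-lines, for which
  orthant dependence is a direct product bound (\<open>upper_orthant_expectation_mixed\<close>).
\<close>


section \<open>Tails of consistently varying distributions\<close>

lemma (in real_distribution) tail_bounds: "0 \<le> tail M x" "tail M x \<le> 1"
  using cdf_bounded_prob[of x] cdf_nonneg[of x] by (auto simp: tail_def)

lemma (in real_distribution) tail_antimono: "x \<le> y \<Longrightarrow> tail M y \<le> tail M x"
  using cdf_nondecreasing[of x y] by (simp add: tail_def)

lemma (in real_distribution) tail_tendsto_0: "(tail M \<longlongrightarrow> 0) at_top"
  using tendsto_diff[OF tendsto_const[of 1] cdf_lim_at_top_prob] by (simp add: tail_def[abs_def])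

lemma consistently_varying_pos: "consistently_varying G \<Longrightarrow> tail G x > 0"
  by (simp add: consistently_varying_def)

lemma consistently_varying_dilation:
  assumes "consistently_varying G" "\<eta> < 1"
  obtains y where "y > 1" "eventually (\<lambda>x. \<eta> * tail G x \<le> tail G (x * y)) at_top"
proof -
  have "eventually (\<lambda>y. ereal \<eta> < Liminf at_top (\<lambda>x. ereal (tail G (x * y) / tail G x))) (at_right 1)"
    using assms by (intro order_tendstoD(1)[where y = 1]) (auto simp: consistently_varying_def)
  then have "eventually (\<lambda>y. 1 < y \<and> ereal \<eta> < Liminf at_top (\<lambda>x. ereal (tail G (x * y) / tail G x))) (at_right 1)"
    by (intro eventually_conj) (auto simp: eventually_at_right_less)
  then obtain y :: real where y: "1 < y" "ereal \<eta> < Liminf at_top (\<lambda>x. ereal (tail G (x * y) / tail G x))"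
    using eventually_happens[of _ "at_right (1::real)"] by auto
  have "eventually (\<lambda>x. \<eta> * tail G x \<le> tail G (x * y)) at_top"
    using less_LiminfD[OF y(2)]
    by eventually_elim
      (use consistently_varying_pos[OF assms(1)] in \<open>auto simp: field_simps intro: less_imp_le\<close>)
  with y(1) that show ?thesis by blast
qed

text \<open>
  Iterating one dilation by some \<open>y > 1\<close> that at most halves the tail gives the bound for all large
  \<open>u\<close>; for the remaining \<open>u\<close> the tail is bounded below, so enlarging the constant suffices. Having
  the inequality for all \<open>u \<ge> 0\<close> spares every later estimate a threshold on \<open>x\<close>. The constant is
  taken to be a power of two so that iterating the halving yields a polynomial bound.
\<close>

lemma (in real_distribution) consistently_varying_doubling:
  assumes "consistently_varying M"
  obtains p :: nat where "\<And>u. u \<ge> 0 \<Longrightarrow> tail M (u / 2) \<le> 2 ^ p * tail M u"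
proof -
  obtain y where y: "y > 1" and ev: "eventually (\<lambda>x. 1/2 * tail M x \<le> tail M (x * y)) at_top"
    using consistently_varying_dilation[OF assms, of "1/2"] by auto
  obtain x1 where x1: "\<And>x. x \<ge> x1 \<Longrightarrow> 1/2 * tail M x \<le> tail M (x * y)"
    using ev by (auto simp: eventually_at_top_linorder)
  define x0 where "x0 = max x1 1"
  have x0: "x0 > 0" "\<And>x. x \<ge> x0 \<Longrightarrow> tail M x \<le> 2 * tail M (x * y)"
    using x1 by (force simp: x0_def)+
  obtain k where k: "2 < y ^ k" using real_arch_pow[OF y, of 2] by auto
  have iter: "tail M x \<le> 2 ^ j * tail M (x * y ^ j)" if "x \<ge> x0" for x j
  proof (induction j)
    case (Suc j)
    have "x * 1 \<le> x * y ^ j"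
      using that y x0(1) by (intro mult_left_mono one_le_power) auto
    then have "tail M (x * y ^ j) \<le> 2 * tail M (x * y ^ j * y)"
      using that by (intro x0(2)) simp
    then have "2 ^ j * tail M (x * y ^ j) \<le> 2 ^ j * (2 * tail M (x * y ^ j * y))"
      by (intro mult_left_mono) auto
    moreover have "2 ^ Suc j * tail M (x * y ^ Suc j) = 2 ^ j * (2 * tail M (x * y ^ j * y))"
      by (simp add: mult_ac)
    ultimately show ?case using Suc by linarith
  qed simp
  obtain l :: nat where l: "1 / tail M (2 * x0) < 2 ^ l"
    using real_arch_pow[of "2::real"] by auto
  define p where "p = max k l"
  have "tail M (u / 2) \<le> 2 ^ p * tail M u" if "u \<ge> 0" for u
  proof (cases "u / 2 \<ge> x0")
    case True
    have "u / 2 * 2 \<le> u / 2 * y ^ k"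
      using k that by (intro mult_left_mono) auto
    then have "u \<le> u / 2 * y ^ k" by simp
    then have "tail M (u / 2 * y ^ k) \<le> tail M u" by (rule tail_antimono)
    then have "tail M (u / 2) \<le> 2 ^ k * tail M u"
      by (intro order_trans[OF iter[OF True, of k]] mult_left_mono) auto
    also have "\<dots> \<le> 2 ^ p * tail M u"
      by (intro mult_right_mono power_increasing) (auto simp: p_def tail_bounds)
    finally show ?thesis .
  next
    case False
    have pos: "tail M (2 * x0) > 0" using consistently_varying_pos[OF assms] .
    have "tail M (u / 2) \<le> 1" by (rule tail_bounds)
    also have "1 \<le> 2 ^ l * tail M (2 * x0)" using l pos by (simp add: field_simps)
    also have "\<dots> \<le> 2 ^ p * tail M u"
      using False by (intro mult_mono power_increasing tail_antimono) (auto simp: p_def tail_bounds)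
    finally show ?thesis .
  qed
  with that show ?thesis by blast
qed

lemma (in real_distribution) tail_scaled_down_le:
  assumes "consistently_varying M" "\<eta> > 1"
  obtains \<delta> where "0 < \<delta>" "\<delta> < 1" "eventually (\<lambda>x. tail M ((1 - \<delta>) * x) \<le> \<eta> * tail M x) at_top"
proof -
  obtain y where y: "y > 1" and ev: "eventually (\<lambda>x. 1/\<eta> * tail M x \<le> tail M (x * y)) at_top"
    using consistently_varying_dilation[OF assms(1), of "1/\<eta>"] assms(2) by auto
  have "filterlim (\<lambda>x. x / y) at_top at_top"
    using y filterlim_tendsto_pos_mult_at_top[OF tendsto_const[of "1 / y"] _ filterlim_ident] by simp
  from eventually_compose_filterlim[OF ev this] 
  have "eventually (\<lambda>x. tail M ((1 - (1 - 1/y)) * x) \<le> \<eta> * tail M x) at_top"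
    by eventually_elim (use y assms(2) in \<open>auto simp: field_simps\<close>)
  moreover have "0 < 1 - 1/y" "1 - 1/y < 1" using y by auto
  ultimately show ?thesis using that by blast
qed

text \<open>
  An additive shift is eventually smaller than any dilation by a factor \<open>y > 1\<close>.
\<close>

lemma (in real_distribution) tail_shift_ratio:
  assumes cv: "consistently_varying M" and a: "a \<ge> 0"
  shows "((\<lambda>x. tail M (x + a) / tail M x) \<longlongrightarrow> 1) at_top"
proof (rule order_tendstoI)
  note pos = consistently_varying_pos[OF cv]
  fix r :: real assume "r < 1"
  then obtain s where s: "r < s" "s < 1" using dense by blast
  obtain y where y: "y > 1" and ev: "eventually (\<lambda>x. s * tail M x \<le> tail M (x * y)) at_top"
    using consistently_varying_dilation[OF cv s(2)] .
  have "eventually (\<lambda>x. x \<ge> a / (y - 1)) at_top" by (rule eventually_ge_at_top)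
  with ev show "eventually (\<lambda>x. r < tail M (x + a) / tail M x) at_top"
  proof eventually_elim
    case (elim x)
    then have "x + a \<le> x * y" using y by (simp add: field_simps)
    then have "s * tail M x \<le> tail M (x + a)" using elim tail_antimono by force
    then have "s \<le> tail M (x + a) / tail M x" using pos[of x] by (simp add: field_simps)
    with s show ?case by simp
  qed
next
  fix r :: real assume "r > 1"
  have "tail M (x + a) / tail M x \<le> 1" for x
    using tail_antimono[of x "x + a"] a consistently_varying_pos[OF cv, of x] by simp
  then show "eventually (\<lambda>x. tail M (x + a) / tail M x < r) at_top"
    using \<open>r > 1\<close> by (intro always_eventually allI) (rule le_less_trans)
qed

section \<open>A Chernoff bound under upper orthant dependence\<close>

text \<open>
  Upper orthant dependence bounds the expectation of a product of increasing functions by the product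
  of the expectations. The increasing functions are those of the form \<open>y \<mapsto> N {..<y}\<close> for a finite Borel
  measure \<open>N\<close>, that is, mixtures of the indicators of \<open>{t<..}\<close>. The induction replaces the event
  \<open>X\<^sub>i > x\<^sub>i\<close> by the function value for one index after the other: expand \<open>N {..<X}\<close> as an integral over
  the threshold \<open>t\<close>, exchange the integrals, and use the induction hypothesis with threshold \<open>t\<close>.
\<close>

lemma (in prob_space) upper_orthant_expectation_mixed:
  fixes X :: "nat \<Rightarrow> 'a \<Rightarrow> real" and N :: "real measure"
  assumes X[measurable]: "\<And>i. i \<ge> 1 \<Longrightarrow> X i \<in> borel_measurable M"
    and N: "finite_measure N" "sets N = sets borel"
    and n: "n \<ge> 1"
    and U: "\<And>x. emeasure M {\<omega> \<in> space M. \<forall>i\<in>{1..n}. X i \<omega> > x i}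
        \<le> K * (\<Prod>i=1..n. emeasure M {\<omega> \<in> space M. X i \<omega> > x i})"
  shows "k \<le> n \<Longrightarrow>
    (\<integral>\<^sup>+\<omega>. (\<Prod>i=1..k. emeasure N {..<X i \<omega>}) *
        indicator {\<omega> \<in> space M. \<forall>i\<in>{k<..n}. X i \<omega> > x i} \<omega> \<partial>M)
      \<le> K * (\<Prod>i=1..k. \<integral>\<^sup>+\<omega>. emeasure N {..<X i \<omega>} \<partial>M) *
          (\<Prod>i\<in>{k<..n}. emeasure M {\<omega> \<in> space M. X i \<omega> > x i})"
proof (induction k arbitrary: x)
  case 0
  have "{0<..n} = {1..n}" by auto
  then show ?case using U[of x] by simp
next
  case (Suc k)
  interpret N: finite_measure N by fact
  interpret P: pair_sigma_finite M N by standard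
  note N(2)[measurable_cong]
  define F where "F y = emeasure N {..<y}" for y
  have F_int: "F y = (\<integral>\<^sup>+t. indicator {t. t < y} t \<partial>N)" for y
    using N(2) by (simp add: F_def lessThan_def)
  have F_meas[measurable]: "F \<in> borel_measurable borel"
    unfolding F_int[abs_def] by measurable
  define g where "g \<omega> = (\<Prod>i=1..k. F (X i \<omega>))" for \<omega>
  define R where "R = {\<omega> \<in> space M. \<forall>i\<in>{Suc k<..n}. X i \<omega> > x i}"
  have [measurable]: "g \<in> borel_measurable M" unfolding g_def by measurable
  have [measurable]: "R \<in> sets M" unfolding R_def by measurable
  have [measurable]: "X (Suc k) \<in> borel_measurable M" by simp
  have split_R: "{\<omega> \<in> space M. \<forall>i\<in>{k<..n}. X i \<omega> > (x(Suc k := t)) i}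
      = {\<omega> \<in> R. X (Suc k) \<omega> > t}" for t
  proof -
    have *: "{k<..n} = insert (Suc k) {Suc k<..n}" using Suc.prems by auto
    show ?thesis unfolding * R_def by auto
  qed
  have prod_R: "(\<Prod>i\<in>{k<..n}. emeasure M {\<omega> \<in> space M. X i \<omega> > (x(Suc k := t)) i})
      = emeasure M {\<omega> \<in> space M. X (Suc k) \<omega> > t} *
        (\<Prod>i\<in>{Suc k<..n}. emeasure M {\<omega> \<in> space M. X i \<omega> > x i})" for t
  proof -
    have *: "{k<..n} = insert (Suc k) {Suc k<..n}" using Suc.prems by auto
    show ?thesis unfolding * by (subst prod.insert) (auto intro!: prod.cong)
  qed
  define C where "C = K * (\<Prod>i=1..k. \<integral>\<^sup>+\<omega>. F (X i \<omega>) \<partial>M)"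
  define D where "D = (\<Prod>i\<in>{Suc k<..n}. emeasure M {\<omega> \<in> space M. X i \<omega> > x i})"
  have "(\<integral>\<^sup>+\<omega>. (\<Prod>i=1..Suc k. F (X i \<omega>)) * indicator R \<omega> \<partial>M)
      = (\<integral>\<^sup>+\<omega>. \<integral>\<^sup>+t. g \<omega> * indicator R \<omega> * indicator {t. t < X (Suc k) \<omega>} t \<partial>N \<partial>M)"
    by (subst nn_integral_cmult) (auto simp: g_def F_int[symmetric] mult_ac)
  also have "\<dots> = (\<integral>\<^sup>+t. \<integral>\<^sup>+\<omega>. g \<omega> * indicator R \<omega> * indicator {t. t < X (Suc k) \<omega>} t \<partial>M \<partial>N)"
    by (rule P.Fubini'[symmetric]) measurable
  also have "\<dots> = (\<integral>\<^sup>+t. \<integral>\<^sup>+\<omega>. g \<omega> *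
      indicator {\<omega> \<in> space M. \<forall>i\<in>{k<..n}. X i \<omega> > (x(Suc k := t)) i} \<omega> \<partial>M \<partial>N)"
    unfolding split_R by (intro nn_integral_cong) (auto split: split_indicator)
  also have "\<dots> \<le> (\<integral>\<^sup>+t. C * (emeasure M {\<omega> \<in> space M. X (Suc k) \<omega> > t} * D) \<partial>N)"
    using Suc.IH Suc.prems unfolding prod_R[symmetric] C_def D_def g_def F_def
    by (intro nn_integral_mono) auto
  also have "\<dots> = C * D * (\<integral>\<^sup>+t. \<integral>\<^sup>+\<omega>. indicator {t. t < X (Suc k) \<omega>} t \<partial>M \<partial>N)"
  proof -
    have *: "emeasure M {\<omega> \<in> space M. X (Suc k) \<omega> > t} = (\<integral>\<^sup>+\<omega>. indicator {t. t < X (Suc k) \<omega>} t \<partial>M)" for t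
    proof -
      have "emeasure M {\<omega> \<in> space M. X (Suc k) \<omega> > t}
          = (\<integral>\<^sup>+\<omega>. indicator {\<omega> \<in> space M. X (Suc k) \<omega> > t} \<omega> \<partial>M)"
        by (rule nn_integral_indicator[symmetric]) measurable
      also have "\<dots> = (\<integral>\<^sup>+\<omega>. indicator {t. t < X (Suc k) \<omega>} t \<partial>M)"
        by (intro nn_integral_cong) (auto split: split_indicator)
      finally show ?thesis .
    qed
    show ?thesis unfolding * by (subst nn_integral_cmult[symmetric]) (auto intro!: nn_integral_cong simp: mult_ac)
  qed
  also have "(\<integral>\<^sup>+t. \<integral>\<^sup>+\<omega>. indicator {t. t < X (Suc k) \<omega>} t \<partial>M \<partial>N) = (\<integral>\<^sup>+\<omega>. F (X (Suc k) \<omega>) \<partial>M)"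
    unfolding F_int by (rule P.Fubini') measurable
  also have "C * D * (\<integral>\<^sup>+\<omega>. F (X (Suc k) \<omega>) \<partial>M) = K * (\<Prod>i=1..Suc k. \<integral>\<^sup>+\<omega>. F (X i \<omega>) \<partial>M) * D"
    by (simp add: C_def mult_ac)
  finally show ?case unfolding R_def D_def F_def .
qed

text \<open>
  Markov's inequality for \<open>exp (h * _)\<close> of the truncated sum; the expectation of the resulting product
  is covered by the previous lemma.
\<close>

lemma (in prob_space) upper_orthant_chernoff:
  fixes X :: "nat \<Rightarrow> 'a \<Rightarrow> real"
  assumes X[measurable]: "\<And>i. i \<ge> 1 \<Longrightarrow> X i \<in> borel_measurable M"
    and D: "\<And>i. i \<ge> 1 \<Longrightarrow> distr M borel (X i) = G"
    and n: "n \<ge> 1" and h: "h > 0"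
    and U: "\<And>x. emeasure M {\<omega> \<in> space M. \<forall>i\<in>{1..n}. X i \<omega> > x i}
        \<le> K * (\<Prod>i=1..n. emeasure M {\<omega> \<in> space M. X i \<omega> > x i})"
  shows "emeasure M {\<omega> \<in> space M. (\<Sum>i=1..n. min (X i \<omega>) b) > x}
    \<le> K * ennreal (exp (- h * x)) * (\<integral>\<^sup>+y. ennreal (exp (h * min y b)) \<partial>G) ^ n"
proof -
  \<comment> \<open>The function \<open>y \<mapsto> exp (h * min y b)\<close> is \<open>y \<mapsto> N {..<y}\<close> for \<open>N\<close> the image of Lebesgue
    measure on the bounded interval \<open>(0, exp (h * b))\<close> under \<open>t \<mapsto> ln t / h\<close>.\<close>
  define L where "L = density lborel (indicator {0<..<exp (h * b)})"
  define N where "N = distr L borel (\<lambda>t. ln t / h)"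
  have "finite_measure L"
    by (rule finite_measureI) (auto simp: L_def emeasure_density)
  then have fin: "finite_measure N"
    unfolding N_def by (rule finite_measure.finite_measure_distr) (simp add: L_def)
  have sets_N: "sets N = sets borel" by (simp add: N_def)
  have F: "emeasure N {..<y} = ennreal (exp (h * min y b))" for y
  proof -
    have iff: "indicator {0<..<exp (h * b)} t * indicator {t. ln t / h < y} t =
        (indicator {0<..<exp (h * min y b)} t :: ennreal)" for t :: real
    proof (cases "t > 0")
      case True
      then have "ln t / h < y \<longleftrightarrow> t < exp (h * y)"
        using h by (metis divide_less_eq exp_less_cancel_iff exp_ln mult.commute)
      moreover have "exp (h * min y b) = min (exp (h * y)) (exp (h * b))"
        using h by (auto simp: min_def)
      ultimately show ?thesis using True by (auto split: split_indicator)
    qed (auto split: split_indicator)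
    have "emeasure N {..<y} = emeasure L ((\<lambda>t. ln t / h) -` {..<y} \<inter> space L)"
      unfolding N_def by (rule emeasure_distr) (auto simp: L_def)
    also have "(\<lambda>t. ln t / h) -` {..<y} \<inter> space L = {t. ln t / h < y}"
      by (auto simp: L_def)
    also have "emeasure L {t. ln t / h < y} =
        (\<integral>\<^sup>+t. indicator {0<..<exp (h * b)} t * indicator {t. ln t / h < y} t \<partial>lborel)"
      unfolding L_def by (rule emeasure_density) auto
    also have "\<dots> = ennreal (exp (h * min y b))"
      unfolding iff by simp
    finally show ?thesis .
  qed
  have "(\<integral>\<^sup>+\<omega>. (\<Prod>i=1..n. emeasure N {..<X i \<omega>}) \<partial>M)
      \<le> K * (\<Prod>i=1..n. \<integral>\<^sup>+\<omega>. emeasure N {..<X i \<omega>} \<partial>M)"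
    using upper_orthant_expectation_mixed[OF X fin sets_N n U, of n undefined]
    by (auto simp: nn_integral_indicator[symmetric] cong: nn_integral_cong)
  also have "(\<Prod>i=1..n. \<integral>\<^sup>+\<omega>. emeasure N {..<X i \<omega>} \<partial>M)
      = (\<Prod>i=1..n. \<integral>\<^sup>+y. ennreal (exp (h * min y b)) \<partial>G)"
  proof (intro prod.cong refl)
    fix i assume "i \<in> {1..n}"
    then have i: "i \<ge> 1" by simp
    show "(\<integral>\<^sup>+\<omega>. emeasure N {..<X i \<omega>} \<partial>M) = (\<integral>\<^sup>+y. ennreal (exp (h * min y b)) \<partial>G)"
      unfolding D[OF i, symmetric] using X[OF i] by (subst nn_integral_distr) (auto simp: F)
  qed
  finally have E: "(\<integral>\<^sup>+\<omega>. (\<Prod>i=1..n. ennreal (exp (h * min (X i \<omega>) b))) \<partial>M)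
      \<le> K * (\<integral>\<^sup>+y. ennreal (exp (h * min y b)) \<partial>G) ^ n"
    by (simp add: F)
  have "emeasure M {\<omega> \<in> space M. (\<Sum>i=1..n. min (X i \<omega>) b) > x}
     = (\<integral>\<^sup>+\<omega>. indicator {\<omega> \<in> space M. (\<Sum>i=1..n. min (X i \<omega>) b) > x} \<omega> \<partial>M)"
    by (subst nn_integral_indicator) auto
  also have "\<dots> \<le> (\<integral>\<^sup>+\<omega>. ennreal (exp (- h * x)) * (\<Prod>i=1..n. ennreal (exp (h * min (X i \<omega>) b))) \<partial>M)"
  proof (intro nn_integral_mono)
    fix \<omega>
    have "(\<Prod>i=1..n. ennreal (exp (h * min (X i \<omega>) b))) = ennreal (exp (h * (\<Sum>i=1..n. min (X i \<omega>) b)))"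
      by (simp add: prod_ennreal exp_sum sum_distrib_left)
    moreover have "1 \<le> exp (- h * x) * exp (h * (\<Sum>i=1..n. min (X i \<omega>) b))"
      if "(\<Sum>i=1..n. min (X i \<omega>) b) > x"
      using that h by (simp flip: exp_add add: algebra_simps)
    ultimately show "indicator {\<omega> \<in> space M. (\<Sum>i=1..n. min (X i \<omega>) b) > x} \<omega>
       \<le> ennreal (exp (- h * x)) * (\<Prod>i=1..n. ennreal (exp (h * min (X i \<omega>) b)))"
      by (auto split: split_indicator simp: ennreal_mult[symmetric])
  qed
  also have "\<dots> = ennreal (exp (- h * x)) * (\<integral>\<^sup>+\<omega>. (\<Prod>i=1..n. ennreal (exp (h * min (X i \<omega>) b))) \<partial>M)"
    by (intro nn_integral_cmult) auto
  also have "\<dots> \<le> ennreal (exp (- h * x)) * (K * (\<integral>\<^sup>+y. ennreal (exp (h * min y b)) \<partial>G) ^ n)"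
    by (intro mult_left_mono E) auto
  finally show ?thesis by (simp add: mult_ac)
qed

section \<open>A uniform one-big-jump bound for the claim sums\<close>

text \<open>
  A single term of the exponential series.
\<close>

lemma power_le_fact_mult_exp: "0 \<le> (t :: real) \<Longrightarrow> t ^ p \<le> fact p * exp t"
proof -
  assume t: "0 \<le> t"
  have "t ^ p / fact p = (\<Sum>k\<in>{p}. t ^ k / fact k)" by simp
  also have "\<dots> \<le> (\<Sum>k. t ^ k / fact k)"
    using t summable_exp[of t] by (intro sum_le_suminf) (auto simp: field_simps)
  also have "\<dots> = exp t" by (simp add: exp_def divide_inverse_commute scaleR_conv_of_real)
  finally show ?thesis by (simp add: field_simps)
qed

text \<open>
  A Potter-type bound: round \<open>A\<close> up to a power of two, which loses at most a factor two, and halve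
  repeatedly.
\<close>

lemma (in real_distribution) tail_div_le:
  assumes double: "\<And>u. u \<ge> 0 \<Longrightarrow> tail M (u / 2) \<le> 2 ^ p * tail M u"
    and A: "A \<ge> 1" and b: "b \<ge> 0"
  shows "tail M (b / A) \<le> (2 * A) ^ p * tail M b"
proof -
  have iter: "tail M (b / 2 ^ k) \<le> (2 ^ k) ^ p * tail M b" for k :: nat
  proof (induction k)
    case (Suc k)
    have "tail M (b / 2 ^ Suc k) \<le> 2 ^ p * tail M (b / 2 ^ k)"
      using double[of "b / 2 ^ k"] b by (simp add: field_simps)
    also have "\<dots> \<le> 2 ^ p * ((2 ^ k) ^ p * tail M b)"
      by (intro mult_left_mono Suc) auto
    finally show ?case by (simp add: power_mult_distrib mult_ac)
  qed simp
  define k where "k = (LEAST k. A \<le> 2 ^ k)"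
  have ex: "\<exists>k. A \<le> 2 ^ k" using real_arch_pow[of 2 A] by (auto intro: less_imp_le)
  then have k: "A \<le> 2 ^ k" unfolding k_def by (rule LeastI_ex)
  have k2: "2 ^ k \<le> 2 * A"
  proof (cases k)
    case 0 then show ?thesis using A by simp
  next
    case (Suc j)
    then have "\<not> A \<le> 2 ^ j" unfolding k_def using not_less_Least by (metis lessI)
    then show ?thesis using Suc by simp
  qed
  have "tail M (b / A) \<le> tail M (b / 2 ^ k)"
    using k A b by (intro tail_antimono divide_left_mono) auto
  also have "\<dots> \<le> (2 ^ k) ^ p * tail M b" by (rule iter)
  also have "\<dots> \<le> (2 * A) ^ p * tail M b"
    by (intro mult_right_mono power_mono k2) (auto simp: tail_bounds)
  finally show ?thesis .
qed

lemma (in prob_space) AE_nonneg_of_distr: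
  fixes X :: "nat \<Rightarrow> 'a \<Rightarrow> real"
  assumes X: "\<And>i. i \<ge> 1 \<Longrightarrow> X i \<in> borel_measurable M"
    and D: "\<And>i. i \<ge> 1 \<Longrightarrow> distr M borel (X i) = H"
    and H: "measure H {0..} = 1"
  shows "AE \<omega> in M. \<forall>i\<ge>1. 0 \<le> X i \<omega>"
proof -
  have "AE \<omega> in M. 0 \<le> X i \<omega>" if i: "i \<ge> 1" for i
  proof -
    interpret D: prob_space "distr M borel (X i)" by (rule prob_space_distr[OF X[OF i]])
    have "AE z in distr M borel (X i). 0 \<le> z"
      using D.AE_prob_1[of "{0..}"] H D[OF i] by simp
    then show ?thesis using X[OF i] by (subst (asm) AE_distr_iff) auto
  qed
  then show ?thesis by (subst AE_all_countable) auto
qed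

locale enod_claims = prob_space M for M :: "'a measure" +
  fixes Y :: "nat \<Rightarrow> 'a \<Rightarrow> real" and G :: "real measure"
  assumes Y_measurable[measurable]: "\<And>i. i \<ge> 1 \<Longrightarrow> Y i \<in> borel_measurable M"
    and Y_distr: "\<And>i. i \<ge> 1 \<Longrightarrow> distr M borel (Y i) = G"
    and Y_ENOD: "ENOD M Y"
    and G_nonneg: "measure G {0..} = 1"
    and G_cv: "consistently_varying G"
    and G_integrable: "integrable G (\<lambda>y. y)"
begin

definition claim_sum :: "nat \<Rightarrow> 'a \<Rightarrow> real" where
  "claim_sum n \<omega> = (\<Sum>i=1..n. Y i \<omega>)"

lemma claim_sum_measurable[measurable]: "claim_sum n \<in> borel_measurable M"
  unfolding claim_sum_def by measurable

end

sublocale enod_claims \<subseteq> G: real_distribution G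
proof -
  have "real_distribution (distr M borel (Y 1))"
    by (rule real_distribution_distr) (rule Y_measurable, simp)
  then show "real_distribution G" by (subst (asm) Y_distr) simp_all
qed

context enod_claims
begin

lemma prob_claim_gt: "i \<ge> 1 \<Longrightarrow> prob {\<omega> \<in> space M. Y i \<omega> > x} = tail G x"
proof -
  assume i: "i \<ge> 1"
  have "tail G x = measure G (space G - {..x})"
    by (subst G.prob_compl) (auto simp: tail_def cdf_def)
  also have "\<dots> = measure (distr M borel (Y i)) {x<..}"
    using Y_distr[OF i] by (intro arg_cong2[where f = measure]) auto
  also have "\<dots> = prob (Y i -` {x<..} \<inter> space M)"
    using Y_measurable[OF i] by (intro measure_distr) auto
  also have "Y i -` {x<..} \<inter> space M = {\<omega> \<in> space M. Y i \<omega> > x}" by auto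
  finally show ?thesis by simp
qed

lemma measure_G_greaterThan: "measure G {x<..} = tail G x"
proof -
  have "{x<..} = space G - {..x}" by auto
  then show ?thesis using G.prob_compl[of "{..x}"] by (simp add: tail_def cdf_def)
qed

lemma AE_G_nonneg: "AE y in G. 0 \<le> y"
  using G.AE_prob_1[OF G_nonneg] by simp

lemma AE_claims_nonneg: "AE \<omega> in M. \<forall>i\<ge>1. 0 \<le> Y i \<omega>"
  by (rule AE_nonneg_of_distr[OF Y_measurable Y_distr G_nonneg])

text \<open>
  All claims have tail \<open>tail G\<close>, so the product bound of orthant dependence can be written in terms
  of \<open>G\<close> alone.
\<close>

lemma upper_orthant_bound:
  obtains K where "K > 0"
    "\<And>n x. n \<ge> 1 \<Longrightarrow> prob {\<omega> \<in> space M. \<forall>i\<in>{1..n}. Y i \<omega> > x i} \<le> K * (\<Prod>i=1..n. tail G (x i))"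
proof -
  obtain K where K: "K > 0" "\<forall>n\<ge>1. \<forall>x. prob {\<omega> \<in> space M. \<forall>i\<in>{1..n}. Y i \<omega> > x i}
      \<le> K * (\<Prod>i=1..n. prob {\<omega> \<in> space M. Y i \<omega> > x i})"
    using Y_ENOD unfolding ENOD_def by blast
  have *: "(\<Prod>i=1..n. prob {\<omega> \<in> space M. Y i \<omega> > x i}) = (\<Prod>i=1..n. tail G (x i))" for n x
    by (intro prod.cong refl prob_claim_gt) auto
  from K that show ?thesis unfolding * by blast
qed

text \<open>
  The dependence condition only speaks of initial segments of the sequence. Two arbitrary indices are
  reached by giving all other indices the threshold \<open>-1\<close>, which a nonnegative claim exceeds anyway.
\<close>

lemma pair_bound:
  obtains K where "K > 0"
    "\<And>i j u. 1 \<le> i \<Longrightarrow> 1 \<le> j \<Longrightarrow> i \<noteq> j \<Longrightarrow>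
       prob {\<omega> \<in> space M. Y i \<omega> > u \<and> Y j \<omega> > u} \<le> K * tail G u ^ 2"
proof -
  obtain K where K: "K > 0" "\<And>n x. n \<ge> 1 \<Longrightarrow>
      prob {\<omega> \<in> space M. \<forall>i\<in>{1..n}. Y i \<omega> > x i} \<le> K * (\<Prod>i=1..n. tail G (x i))"
    using upper_orthant_bound by blast
  have "prob {\<omega> \<in> space M. Y i \<omega> > u \<and> Y j \<omega> > u} \<le> K * tail G u ^ 2"
    if ij: "1 \<le> i" "1 \<le> j" "i \<noteq> j" for i j u
  proof -
    define n where "n = max i j"
    define x where "x k = (if k \<in> {i, j} then u else -1)" for k :: nat
    have n: "n \<ge> 1" "{i, j} \<subseteq> {1..n}" using ij by (auto simp: n_def)
    have "prob {\<omega> \<in> space M. Y i \<omega> > u \<and> Y j \<omega> > u} \<le> prob {\<omega> \<in> space M. \<forall>k\<in>{1..n}. Y k \<omega> > x k}"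
    proof (rule finite_measure_mono_AE)
      show "AE \<omega> in M. \<omega> \<in> {\<omega> \<in> space M. Y i \<omega> > u \<and> Y j \<omega> > u} \<longrightarrow>
          \<omega> \<in> {\<omega> \<in> space M. \<forall>k\<in>{1..n}. Y k \<omega> > x k}"
        using AE_claims_nonneg by eventually_elim (force simp: x_def)
    qed measurable
    also have "\<dots> \<le> K * (\<Prod>k=1..n. tail G (x k))" by (rule K(2)[OF n(1)])
    also have "(\<Prod>k=1..n. tail G (x k)) = (\<Prod>k\<in>{1..n} - {i, j}. tail G (x k)) * (\<Prod>k\<in>{i, j}. tail G (x k))"
      by (rule prod.subset_diff) (use n in auto)
    also have "\<dots> \<le> 1 * (\<Prod>k\<in>{i, j}. tail G (x k))"
      by (intro mult_right_mono prod_le_1 prod_nonneg) (auto simp: G.tail_bounds)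
    also have "\<dots> = tail G u ^ 2" using ij(3) by (simp add: x_def power2_eq_square)
    finally show ?thesis using K(1) by simp
  qed
  with K(1) that show ?thesis by blast
qed

text \<open>
  A moment generating function is controlled by splitting at \<open>b / A\<close> and \<open>b / 2\<close>: below \<open>b / A\<close> the
  exponent is at most \<open>1\<close>, so the exponential is at most \<open>1 + 2 * h * y\<close>; between the two it is at most \<open>A / 2\<close>;
  above \<open>b / 2\<close> only the truncation helps, and the exponent is at most \<open>A\<close>.
\<close>

lemma exponential_moment_bound:
  assumes b: "b > 0" and A: "A > 1"
  defines "h \<equiv> A / b"
  shows "(\<integral>\<^sup>+y. ennreal (exp (h * min y b)) \<partial>G)
     \<le> ennreal (1 + 2 * h * (\<integral>y. y \<partial>G) + exp (A / 2) * tail G (b / A) + exp A * tail G (b / 2))"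
proof -
  define f where "f y = 1 + 2 * h * y + exp (A / 2) * indicator {b / A<..} y + exp A * indicator {b / 2<..} y" for y :: real
  have h: "h > 0" "h * b = A" using b A by (auto simp: h_def)
  have pointwise: "exp (h * min y b) \<le> f y" if y: "y \<ge> 0" for y
  proof -
    consider "y \<le> b / A" | "b / A < y" "y \<le> b / 2" | "b / 2 < y" by linarith
    then show ?thesis
    proof cases
      case 1
      then have "h * y \<le> 1" using A b by (simp add: h_def field_simps)
      then have "exp (h * y) \<le> 1 + h * y + (h * y)\<^sup>2" using y h by (intro exp_bound) auto
      also have "(h * y)\<^sup>2 \<le> h * y"
        using \<open>h * y \<le> 1\<close> y h by (simp add: power2_eq_square mult_left_le)
      finally have "exp (h * y) \<le> 1 + 2 * h * y" by simp
      moreover have "exp (h * min y b) \<le> exp (h * y)" using h by simp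
      moreover have "1 + 2 * h * y \<le> f y" by (auto simp: f_def indicator_def)
      ultimately show ?thesis by linarith
    next
      case 2
      have "h * min y b \<le> h * (b / 2)" using 2 h by (intro mult_left_mono) auto
      then have "exp (h * min y b) \<le> exp (A / 2)" using h by (subst exp_le_cancel_iff) simp
      moreover have "0 \<le> h * y" using h y by simp
      moreover have "exp (A / 2) + 2 * (h * y) \<le> f y" using 2 by (auto simp: f_def indicator_def)
      ultimately show ?thesis by linarith
    next
      case 3
      have "h * min y b \<le> h * b" using h by (intro mult_left_mono) auto
      then have "exp (h * min y b) \<le> exp A" using h by simp
      moreover have "0 \<le> h * y" using h y by simp
      moreover have "exp A + 2 * (h * y) \<le> f y" using 3 by (auto simp: f_def indicator_def)
      ultimately show ?thesis by linarith
    qed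
  qed
  have ind: "integrable G (indicator {t<..} :: real \<Rightarrow> real)" for t
    by (rule integrable_real_indicator) (auto simp: G.emeasure_eq_measure)
  have int: "integrable G f"
    unfolding f_def by (intro Bochner_Integration.integrable_add integrable_mult_right G_integrable ind) auto
  have "(\<integral>\<^sup>+y. ennreal (exp (h * min y b)) \<partial>G) \<le> (\<integral>\<^sup>+y. ennreal (f y) \<partial>G)"
  proof (rule nn_integral_mono_AE)
    show "AE y in G. ennreal (exp (h * min y b)) \<le> ennreal (f y)"
      using AE_G_nonneg by eventually_elim (intro ennreal_leI pointwise)
  qed
  also have "\<dots> = ennreal (\<integral>y. f y \<partial>G)"
  proof (rule nn_integral_eq_integral[OF int])
    show "AE y in G. 0 \<le> f y" using AE_G_nonneg
      by eventually_elim (use h in \<open>auto simp: f_def intro!: add_nonneg_nonneg\<close>)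
  qed
  also have "(\<integral>y. f y \<partial>G) = 1 + 2 * h * (\<integral>y. y \<partial>G) + exp (A / 2) * tail G (b / A) + exp A * tail G (b / 2)"
    unfolding f_def using G_integrable G.prob_space ind
    by (simp add: measure_G_greaterThan)
  finally show ?thesis .
qed

lemma mean_nonneg: "0 \<le> (\<integral>y. y \<partial>G)"
  using AE_G_nonneg by (rule integral_nonneg_AE)

text \<open>
  With \<open>b = x / 2\<close> and \<open>d = n * tail G b\<close>, the Chernoff parameter is \<open>h = A / b\<close> for \<open>A = - ln d\<close>, so
  that \<open>exp A = 1 / d\<close>. Then each of the two terms of \<open>exponential_moment_bound\<close> with a tail, multiplied
  by \<open>n\<close>, is bounded by a constant: the one at \<open>b / 2\<close> by doubling, and the one at \<open>b / A\<close> because the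
  polynomial loss \<open>(2 * A) ^ p\<close> is absorbed by \<open>exp (- A / 2)\<close>. The linear term eats up at most half of
  \<open>h * x = 2 * A\<close> by the assumption \<open>4 \<mu> n \<le> x\<close>, which leaves \<open>exp (- A) = d\<close>.
\<close>

lemma truncated_sum_bound:
  obtains C where "C > 0"
    "\<And>n x. n \<ge> 1 \<Longrightarrow> x > 0 \<Longrightarrow> 4 * (\<integral>y. y \<partial>G) * real n \<le> x \<Longrightarrow> real n * tail G (x / 2) < exp (-1) \<Longrightarrow>
       prob {\<omega> \<in> space M. (\<Sum>i=1..n. min (Y i \<omega>) (x / 2)) > x} \<le> C * real n * tail G (x / 2)"
proof -
  obtain K where K: "K > 0" "\<And>n x. n \<ge> 1 \<Longrightarrow>
      prob {\<omega> \<in> space M. \<forall>i\<in>{1..n}. Y i \<omega> > x i} \<le> K * (\<Prod>i=1..n. tail G (x i))"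
    using upper_orthant_bound by blast
  obtain p :: nat where p: "\<And>u. u \<ge> 0 \<Longrightarrow> tail G (u / 2) \<le> 2 ^ p * tail G u"
    using G.consistently_varying_doubling[OF G_cv] by blast
  define \<mu> where "\<mu> = (\<integral>y. y \<partial>G)"
  define B where "B = (4 ^ p * fact p + 2 ^ p :: real)"
  have "prob {\<omega> \<in> space M. (\<Sum>i=1..n. min (Y i \<omega>) (x / 2)) > x} \<le> K * exp B * real n * tail G (x / 2)"
    if n: "n \<ge> 1" and x: "x > 0" "4 * \<mu> * real n \<le> x" "real n * tail G (x / 2) < exp (-1)" for n x
  proof -
    define b where "b = x / 2"
    define d where "d = real n * tail G b"
    define A where "A = - ln d"
    define h where "h = A / b"
    define s where "s = 2 * h * \<mu> + exp (A / 2) * tail G (b / A) + exp A * tail G (b / 2)"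
    have b: "b > 0" using x by (simp add: b_def)
    have d: "d > 0" "d < exp (-1)"
      using n x consistently_varying_pos[OF G_cv] by (auto simp: d_def b_def)
    have "ln d < ln (exp (-1))" using d by (intro ln_less_cancel_iff[THEN iffD2]) auto
    then have A: "A > 1" by (simp add: A_def)
    have expA: "exp (- A) = d" using d by (simp add: A_def)
    have h: "h > 0" "h * x = 2 * A" using A b by (auto simp: h_def b_def field_simps)
    have s: "s \<ge> 0"
      unfolding s_def using h mean_nonneg by (auto intro!: add_nonneg_nonneg simp: \<mu>_def G.tail_bounds)
    have ns: "real n * s \<le> A + B"
    proof -
      have "real n * (2 * h * \<mu>) = h * (4 * \<mu> * real n) / 2" by simp
      also have "\<dots> \<le> h * x / 2" using x(2) h(1) by (intro divide_right_mono mult_left_mono) auto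
      finally have 1: "real n * (2 * h * \<mu>) \<le> A" using h(2) by simp
      have "real n * (exp (A / 2) * tail G (b / A)) \<le> real n * (exp (A / 2) * ((2 * A) ^ p * tail G b))"
        using G.tail_div_le[OF p, of A b] A b by (intro mult_left_mono) auto
      also have "\<dots> = exp (A / 2) * (2 * A) ^ p * d" by (simp add: d_def)
      also have "\<dots> = (2 * A) ^ p * exp (- (A / 2))"
        unfolding expA[symmetric] by (simp flip: exp_add add: mult_ac)
      also have "(2 * A) ^ p = 4 ^ p * (A / 2) ^ p"
        using power_mult_distrib[of 4 "A / 2" p] by simp
      also have "4 ^ p * (A / 2) ^ p * exp (- (A / 2)) \<le> 4 ^ p * (fact p * exp (A / 2)) * exp (- (A / 2))"
        using A by (intro mult_left_mono mult_right_mono power_le_fact_mult_exp) auto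
      also have "\<dots> = 4 ^ p * fact p" by (simp add: exp_minus)
      finally have 2: "real n * (exp (A / 2) * tail G (b / A)) \<le> 4 ^ p * fact p" .
      have "real n * (exp A * tail G (b / 2)) \<le> real n * (exp A * (2 ^ p * tail G b))"
        using p[of b] b by (intro mult_left_mono) auto
      also have "\<dots> = 2 ^ p * (exp A * d)" by (simp add: d_def)
      also have "exp A * d = 1" unfolding expA[symmetric] by (simp add: exp_minus)
      finally have 3: "real n * (exp A * tail G (b / 2)) \<le> 2 ^ p" by simp
      from 1 2 3 show ?thesis by (simp add: s_def B_def algebra_simps)
    qed
    have U: "emeasure M {\<omega> \<in> space M. \<forall>i\<in>{1..n}. Y i \<omega> > z i}
        \<le> ennreal K * (\<Prod>i=1..n. emeasure M {\<omega> \<in> space M. Y i \<omega> > z i})" for z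
    proof -
      have "(\<Prod>i=1..n. emeasure M {\<omega> \<in> space M. Y i \<omega> > z i}) = (\<Prod>i=1..n. ennreal (tail G (z i)))"
        by (intro prod.cong refl) (simp add: emeasure_eq_measure prob_claim_gt)
      then show ?thesis using K(2)[OF n, of z] K(1)
        by (simp add: emeasure_eq_measure prod_ennreal G.tail_bounds ennreal_mult[symmetric] prod_nonneg ennreal_leI)
    qed
    have "emeasure M {\<omega> \<in> space M. (\<Sum>i=1..n. min (Y i \<omega>) b) > x}
      \<le> ennreal K * ennreal (exp (- h * x)) * (\<integral>\<^sup>+y. ennreal (exp (h * min y b)) \<partial>G) ^ n"
      by (rule upper_orthant_chernoff[OF Y_measurable Y_distr n h(1) U])
    also have "\<dots> \<le> ennreal K * ennreal (exp (- h * x)) * ennreal (1 + s) ^ n"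
      using exponential_moment_bound[OF b A]
      by (intro mult_left_mono power_mono) (auto simp: s_def h_def \<mu>_def add_ac)
    also have "\<dots> = ennreal (K * exp (- h * x) * (1 + s) ^ n)"
      using K(1) s by (subst ennreal_power) (auto simp: ennreal_mult simp del: ennreal_plus)
    finally have "prob {\<omega> \<in> space M. (\<Sum>i=1..n. min (Y i \<omega>) b) > x} \<le> K * exp (- h * x) * (1 + s) ^ n"
      using K(1) s by (simp add: emeasure_eq_measure)
    also have "(1 + s) ^ n \<le> exp s ^ n" using s by (intro power_mono exp_ge_add_one_self) auto
    also have "exp s ^ n = exp (real n * s)" by (simp add: exp_of_nat_mult)
    also have "\<dots> \<le> exp (A + B)" using ns by simp
    also have "K * exp (- h * x) * exp (A + B) = K * exp B * d"
    proof -
      have "- h * x + (A + B) = B - A" using h(2) by simp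
      then show ?thesis unfolding expA[symmetric] by (simp flip: exp_add add: mult.assoc)
    qed
    finally show ?thesis using K(1) by (simp add: b_def d_def mult_ac)
  qed
  with that[of "K * exp B"] K(1) show ?thesis unfolding \<mu>_def by simp
qed

text \<open>
  Either some claim exceeds \<open>x / 2\<close>, or truncation at \<open>x / 2\<close> does not change the sum. If
  \<open>n * tail G (x / 2)\<close> is not small, then the bound holds trivially since probabilities are at most \<open>1\<close>.
\<close>

lemma uniform_sum_tail_bound:
  obtains C where "C > 0"
    "\<And>n x. n \<ge> 1 \<Longrightarrow> x > 0 \<Longrightarrow> 4 * (\<integral>y. y \<partial>G) * real n \<le> x \<Longrightarrow>
       prob {\<omega> \<in> space M. claim_sum n \<omega> > x} \<le> C * real n * tail G x"
proof -
  obtain C where C: "C > 0"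
    "\<And>n x. n \<ge> 1 \<Longrightarrow> x > 0 \<Longrightarrow> 4 * (\<integral>y. y \<partial>G) * real n \<le> x \<Longrightarrow> real n * tail G (x / 2) < exp (-1) \<Longrightarrow>
       prob {\<omega> \<in> space M. (\<Sum>i=1..n. min (Y i \<omega>) (x / 2)) > x} \<le> C * real n * tail G (x / 2)"
    using truncated_sum_bound by blast
  obtain p :: nat where p: "\<And>u. u \<ge> 0 \<Longrightarrow> tail G (u / 2) \<le> 2 ^ p * tail G u"
    using G.consistently_varying_doubling[OF G_cv] by blast
  define C' where "C' = max (1 + C) (exp 1)"
  have "prob {\<omega> \<in> space M. claim_sum n \<omega> > x} \<le> C' * 2 ^ p * real n * tail G x"
    if n: "n \<ge> 1" and x: "x > 0" "4 * (\<integral>y. y \<partial>G) * real n \<le> x" for n x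
  proof -
    have "prob {\<omega> \<in> space M. claim_sum n \<omega> > x} \<le> C' * (real n * tail G (x / 2))"
    proof (cases "real n * tail G (x / 2) < exp (-1)")
      case True
      let ?A = "\<lambda>i. {\<omega> \<in> space M. Y i \<omega> > x / 2}"
      let ?T = "{\<omega> \<in> space M. (\<Sum>i=1..n. min (Y i \<omega>) (x / 2)) > x}"
      have "{\<omega> \<in> space M. claim_sum n \<omega> > x} \<subseteq> (\<Union>i\<in>{1..n}. ?A i) \<union> ?T"
      proof
        fix \<omega> assume w: "\<omega> \<in> {\<omega> \<in> space M. claim_sum n \<omega> > x}"
        show "\<omega> \<in> (\<Union>i\<in>{1..n}. ?A i) \<union> ?T"
        proof (cases "\<exists>i\<in>{1..n}. Y i \<omega> > x / 2")
          case False
          then have "(\<Sum>i=1..n. min (Y i \<omega>) (x / 2)) = claim_sum n \<omega>"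
            unfolding claim_sum_def by (intro sum.cong) (auto simp: min_def not_less)
          then show ?thesis using w by auto
        qed (use w in auto)
      qed
      then have "prob {\<omega> \<in> space M. claim_sum n \<omega> > x} \<le> prob ((\<Union>i\<in>{1..n}. ?A i) \<union> ?T)"
        by (rule finite_measure_mono) (auto intro!: sets.Un sets.finite_UN)
      also have "\<dots> \<le> prob (\<Union>i\<in>{1..n}. ?A i) + prob ?T"
        by (rule measure_Un_le) (auto intro!: sets.finite_UN)
      also have "prob (\<Union>i\<in>{1..n}. ?A i) \<le> (\<Sum>i\<in>{1..n}. prob (?A i))"
        by (rule measure_UNION_le) auto
      also have "(\<Sum>i\<in>{1..n}. prob (?A i)) = real n * tail G (x / 2)"
        by (subst sum.cong[OF refl prob_claim_gt]) auto
      also have "prob ?T \<le> C * real n * tail G (x / 2)" by (rule C(2)[OF n x True])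
      also have "real n * tail G (x / 2) + C * real n * tail G (x / 2) = (1 + C) * (real n * tail G (x / 2))"
        by (simp add: algebra_simps)
      also have "\<dots> \<le> C' * (real n * tail G (x / 2))"
        by (intro mult_right_mono) (auto simp: C'_def G.tail_bounds)
      finally show ?thesis by simp
    next
      case False
      have "prob {\<omega> \<in> space M. claim_sum n \<omega> > x} \<le> exp 1 * exp (-1)" by (simp flip: exp_add)
      also have "\<dots> \<le> C' * (real n * tail G (x / 2))"
        using False C(1) by (intro mult_mono) (auto simp: C'_def)
      finally show ?thesis .
    qed
    also have "\<dots> \<le> C' * (real n * (2 ^ p * tail G x))"
      using p[of x] x C(1) by (intro mult_left_mono) (auto simp: C'_def)
    finally show ?thesis by (simp add: mult_ac)
  qed
  moreover have "C' * 2 ^ p > 0" using C(1) by (simp add: C'_def)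
  ultimately show ?thesis using that by blast
qed

end

section \<open>Tail asymptotics for a fixed number of claims\<close>

context enod_claims
begin

lemma max_tail_upper: "prob {\<omega> \<in> space M. \<exists>i\<in>{1..n}. Y i \<omega> > x} \<le> real n * tail G x"
proof -
  have "prob {\<omega> \<in> space M. \<exists>i\<in>{1..n}. Y i \<omega> > x} = prob (\<Union>i\<in>{1..n}. {\<omega> \<in> space M. Y i \<omega> > x})"
    by (intro arg_cong[where f = prob]) auto
  also have "\<dots> \<le> (\<Sum>i\<in>{1..n}. prob {\<omega> \<in> space M. Y i \<omega> > x})"
    by (rule measure_UNION_le) auto
  also have "\<dots> = real n * tail G x"
    by (subst sum.cong[OF refl prob_claim_gt]) auto
  finally show ?thesis .
qed

text \<open>
  Bonferroni's inequality, with the crude count \<open>n\<^sup>2\<close> of pairs.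
\<close>

lemma max_tail_lower:
  assumes K: "\<And>i j. 1 \<le> i \<Longrightarrow> 1 \<le> j \<Longrightarrow> i \<noteq> j \<Longrightarrow> prob {\<omega> \<in> space M. Y i \<omega> > x \<and> Y j \<omega> > x} \<le> q"
    and q: "q \<ge> 0"
  shows "real n * tail G x - real n ^ 2 * q \<le> prob {\<omega> \<in> space M. \<exists>i\<in>{1..n}. Y i \<omega> > x}"
proof (induction n)
  case (Suc n)
  let ?U = "{\<omega> \<in> space M. \<exists>i\<in>{1..n}. Y i \<omega> > x}"
  let ?B = "{\<omega> \<in> space M. Y (Suc n) \<omega> > x}"
  have "prob (?U \<inter> ?B) = prob (\<Union>i\<in>{1..n}. {\<omega> \<in> space M. Y i \<omega> > x \<and> Y (Suc n) \<omega> > x})"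
    by (intro arg_cong[where f = prob]) auto
  also have "\<dots> \<le> (\<Sum>i\<in>{1..n}. prob {\<omega> \<in> space M. Y i \<omega> > x \<and> Y (Suc n) \<omega> > x})"
    by (rule measure_UNION_le) auto
  also have "\<dots> \<le> (\<Sum>i\<in>{1..n}. q)"
    by (intro sum_mono K) auto
  finally have int: "prob (?U \<inter> ?B) \<le> real n * q" by simp
  have "prob (?U \<union> ?B) = prob ?U + prob ?B - prob (?U \<inter> ?B)"
    by (subst measure_Un3) (auto simp: fmeasurable_eq_sets)
  moreover have "?U \<union> ?B = {\<omega> \<in> space M. \<exists>i\<in>{1..Suc n}. Y i \<omega> > x}"
    by (auto simp: atLeastAtMostSuc_conv)
  moreover have "prob ?B = tail G x" by (rule prob_claim_gt) simp
  moreover have "real (Suc n) * tail G x = real n * tail G x + tail G x" by (simp add: algebra_simps)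
  moreover have "real n ^ 2 * q + real n * q \<le> real (Suc n) ^ 2 * q"
    using q by (simp add: power2_eq_square algebra_simps)
  ultimately show ?case using Suc int by simp
qed simp

lemma max_tail_limit:
  "((\<lambda>x. prob {\<omega> \<in> space M. \<exists>i\<in>{1..n}. Y i \<omega> > x} / tail G x) \<longlongrightarrow> real n) at_top"
proof -
  obtain K where K: "K > 0"
    "\<And>i j u. 1 \<le> i \<Longrightarrow> 1 \<le> j \<Longrightarrow> i \<noteq> j \<Longrightarrow>
       prob {\<omega> \<in> space M. Y i \<omega> > u \<and> Y j \<omega> > u} \<le> K * tail G u ^ 2"
    using pair_bound by blast
  note pos = consistently_varying_pos[OF G_cv]
  have lim: "((\<lambda>x. real n - real n ^ 2 * K * tail G x) \<longlongrightarrow> real n - real n ^ 2 * K * 0) at_top"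
    by (intro tendsto_intros G.tail_tendsto_0)
  show ?thesis
  proof (rule tendsto_sandwich[OF _ _ _ tendsto_const])
    show "((\<lambda>x. real n - real n ^ 2 * K * tail G x) \<longlongrightarrow> real n) at_top"
      using lim by simp
    have "(real n - real n ^ 2 * K * tail G x) * tail G x \<le> prob {\<omega> \<in> space M. \<exists>i\<in>{1..n}. Y i \<omega> > x}" for x
      using max_tail_lower[of x "K * tail G x ^ 2" n] K
      by (simp add: algebra_simps power2_eq_square)
    then show "\<forall>\<^sub>F x in at_top. real n - real n ^ 2 * K * tail G x
        \<le> prob {\<omega> \<in> space M. \<exists>i\<in>{1..n}. Y i \<omega> > x} / tail G x"
      using pos by (simp add: pos_le_divide_eq)
    show "\<forall>\<^sub>F x in at_top. prob {\<omega> \<in> space M. \<exists>i\<in>{1..n}. Y i \<omega> > x} / tail G x \<le> real n"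
      using max_tail_upper pos by (simp add: pos_divide_le_eq)
  qed
qed

text \<open>
  If no claim exceeds \<open>(1 - \<delta>) x\<close> and at most one exceeds \<open>\<delta> x / n\<close>, then the sum is at most
  \<open>(1 - \<delta>) x + n (\<delta> x / n) = x\<close>.
\<close>

lemma sum_tail_upper:
  assumes K: "\<And>i j. 1 \<le> i \<Longrightarrow> 1 \<le> j \<Longrightarrow> i \<noteq> j \<Longrightarrow>
       prob {\<omega> \<in> space M. Y i \<omega> > \<delta> * x / n \<and> Y j \<omega> > \<delta> * x / n} \<le> q"
    and n: "n \<ge> 1" and \<delta>: "0 < \<delta>" "\<delta> < 1" and x: "x > 0"
  shows "prob {\<omega> \<in> space M. claim_sum n \<omega> > x} \<le> real n * tail G ((1 - \<delta>) * x) + real n ^ 2 * q"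
proof -
  define u where "u = \<delta> * x / n"
  let ?P = "{1..n} \<times> {1..n} - Id"
  let ?A = "{\<omega> \<in> space M. \<exists>i\<in>{1..n}. Y i \<omega> > (1 - \<delta>) * x}"
  let ?B = "\<Union>(i, j)\<in>?P. {\<omega> \<in> space M. Y i \<omega> > u \<and> Y j \<omega> > u}"
  have q: "q \<ge> 0" using K[of 1 2] measure_nonneg by (rule order_trans[rotated]) auto
  have u: "u > 0" "real n * u = \<delta> * x" using n \<delta> x by (auto simp: u_def)
  have "{\<omega> \<in> space M. claim_sum n \<omega> > x} \<subseteq> ?A \<union> ?B"
  proof
    fix \<omega> assume w: "\<omega> \<in> {\<omega> \<in> space M. claim_sum n \<omega> > x}"
    show "\<omega> \<in> ?A \<union> ?B"
    proof (rule ccontr)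
      assume "\<omega> \<notin> ?A \<union> ?B"
      then have nA: "\<omega> \<notin> ?A" and nB: "\<omega> \<notin> ?B" by auto
      from w nA have le: "\<And>i. i \<in> {1..n} \<Longrightarrow> Y i \<omega> \<le> (1 - \<delta>) * x"
        by (auto simp: not_less)
      have one: "Y j \<omega> \<le> u" if "i \<in> {1..n}" "j \<in> {1..n}" "i \<noteq> j" "Y i \<omega> > u" for i j
      proof (rule ccontr)
        assume "\<not> Y j \<omega> \<le> u"
        then have "\<omega> \<in> ?B" using that w by (intro UN_I[of "(i, j)"]) auto
        with nB show False by simp
      qed
      have "claim_sum n \<omega> \<le> x"
      proof (cases "\<exists>i\<in>{1..n}. Y i \<omega> > u")
        case False
        then have "claim_sum n \<omega> \<le> (\<Sum>i=1..n. u)"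
          unfolding claim_sum_def by (intro sum_mono) (force simp: not_less)
        also have "\<dots> = \<delta> * x" using u by simp
        also have "\<dots> \<le> 1 * x" using \<delta> x by (intro mult_right_mono) auto
        finally show ?thesis by simp
      next
        case True
        then obtain i where i: "i \<in> {1..n}" "Y i \<omega> > u" by blast
        have "claim_sum n \<omega> = Y i \<omega> + (\<Sum>j\<in>{1..n} - {i}. Y j \<omega>)"
          unfolding claim_sum_def using i by (subst sum.remove[of _ i]) auto
        also have "\<dots> \<le> (1 - \<delta>) * x + (\<Sum>j\<in>{1..n} - {i}. u)"
          using le one i by (intro add_mono sum_mono) auto
        also have "(\<Sum>j\<in>{1..n} - {i}. u) \<le> (\<Sum>j=1..n. u)"
          using u by (intro sum_mono2) auto
        also have "\<dots> = \<delta> * x" using u by simp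
        finally show ?thesis by (simp add: algebra_simps)
      qed
      with w show False by simp
    qed
  qed
  then have "prob {\<omega> \<in> space M. claim_sum n \<omega> > x} \<le> prob (?A \<union> ?B)"
    by (rule finite_measure_mono) (auto intro!: sets.Un sets.finite_UN)
  also have "\<dots> \<le> prob ?A + prob ?B"
    by (rule measure_Un_le) (auto intro!: sets.finite_UN)
  also have "prob ?A \<le> real n * tail G ((1 - \<delta>) * x)" by (rule max_tail_upper)
  also have "prob ?B \<le> (\<Sum>p\<in>?P. prob (case p of (i, j) \<Rightarrow> {\<omega> \<in> space M. Y i \<omega> > u \<and> Y j \<omega> > u}))"
    by (rule measure_UNION_le) auto
  also have "\<dots> \<le> (\<Sum>p\<in>?P. q)"
  proof (intro sum_mono)
    fix p assume "p \<in> ?P"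
    then obtain i j where "p = (i, j)" "1 \<le> i" "1 \<le> j" "i \<noteq> j" by (cases p) auto
    then show "prob (case p of (i, j) \<Rightarrow> {\<omega> \<in> space M. Y i \<omega> > u \<and> Y j \<omega> > u}) \<le> q"
      using K[of i j] by (simp add: u_def)
  qed
  also have "\<dots> \<le> (\<Sum>p\<in>{1..n} \<times> {1..n}. q)"
    using q by (intro sum_mono2) auto
  also have "\<dots> = real n ^ 2 * q" by (simp add: power2_eq_square)
  finally show ?thesis by simp
qed

lemma claim_sum_ge_max:
  "prob {\<omega> \<in> space M. \<exists>i\<in>{1..n}. Y i \<omega> > x} \<le> prob {\<omega> \<in> space M. claim_sum n \<omega> > x}"
proof (rule finite_measure_mono_AE)
  show "AE \<omega> in M. \<omega> \<in> {\<omega> \<in> space M. \<exists>i\<in>{1..n}. Y i \<omega> > x} \<longrightarrow> \<omega> \<in> {\<omega> \<in> space M. claim_sum n \<omega> > x}"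
    using AE_claims_nonneg
  proof eventually_elim
    case (elim \<omega>)
    have "Y i \<omega> \<le> claim_sum n \<omega>" if "i \<in> {1..n}" for i
      unfolding claim_sum_def using that elim by (intro member_le_sum) auto
    then show ?case by force
  qed
qed measurable

lemma sum_tail_limit:
  "((\<lambda>x. prob {\<omega> \<in> space M. claim_sum n \<omega> > x} / tail G x) \<longlongrightarrow> real n) at_top"
proof (cases "n = 0")
  case True
  have "eventually (\<lambda>x. prob {\<omega> \<in> space M. claim_sum n \<omega> > x} / tail G x = real n) at_top"
    using eventually_gt_at_top[of 0]
  proof eventually_elim
    case (elim x)
    then have "{\<omega> \<in> space M. claim_sum n \<omega> > x} = {}" by (auto simp: True claim_sum_def)
    then show ?case by (simp only: True) simp
  qed
  then show ?thesis by (rule tendsto_eventually)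
next
  case False
  note pos = consistently_varying_pos[OF G_cv]
  obtain K where K: "K > 0"
    "\<And>i j u. 1 \<le> i \<Longrightarrow> 1 \<le> j \<Longrightarrow> i \<noteq> j \<Longrightarrow>
       prob {\<omega> \<in> space M. Y i \<omega> > u \<and> Y j \<omega> > u} \<le> K * tail G u ^ 2"
    using pair_bound by blast
  obtain p :: nat where p: "\<And>u. u \<ge> 0 \<Longrightarrow> tail G (u / 2) \<le> 2 ^ p * tail G u"
    using G.consistently_varying_doubling[OF G_cv] by blast
  show ?thesis
  proof (rule order_tendstoI)
    fix r assume "r < real n"
    with max_tail_limit[of n] have "\<forall>\<^sub>F x in at_top. r < prob {\<omega> \<in> space M. \<exists>i\<in>{1..n}. Y i \<omega> > x} / tail G x"
      by (rule order_tendstoD)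
    then show "\<forall>\<^sub>F x in at_top. r < prob {\<omega> \<in> space M. claim_sum n \<omega> > x} / tail G x"
      by eventually_elim
        (erule less_le_trans, intro divide_right_mono claim_sum_ge_max less_imp_le[OF pos])
  next
    fix r assume r: "r > real n"
    \<comment> \<open>Halfway between \<open>1\<close> and \<open>r / n\<close>, so that \<open>n * \<eta> < r\<close>.\<close>
    define \<eta> where "\<eta> = (1 + r / n) / 2"
    have \<eta>: "\<eta> > 1" "real n * \<eta> < r" using r False by (auto simp: \<eta>_def field_simps)
    obtain \<delta> where \<delta>: "0 < \<delta>" "\<delta> < 1"
      and ev: "eventually (\<lambda>x. tail G ((1 - \<delta>) * x) \<le> \<eta> * tail G x) at_top"
      using G.tail_scaled_down_le[OF G_cv \<eta>(1)] .
    define D where "D = (2 * (real n / \<delta>)) ^ p"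
    have "((\<lambda>x. real n * \<eta> + real n ^ 2 * K * D ^ 2 * tail G x)
        \<longlongrightarrow> real n * \<eta> + real n ^ 2 * K * D ^ 2 * 0) at_top"
      by (intro tendsto_intros G.tail_tendsto_0)
    then have "eventually (\<lambda>x. real n * \<eta> + real n ^ 2 * K * D ^ 2 * tail G x < r) at_top"
      using \<eta>(2) by (intro order_tendstoD) auto
    with ev eventually_gt_at_top[of 0]
    show "\<forall>\<^sub>F x in at_top. prob {\<omega> \<in> space M. claim_sum n \<omega> > x} / tail G x < r"
    proof eventually_elim
      case (elim x)
      have "tail G (\<delta> * x / n) \<le> D * tail G x"
        using G.tail_div_le[OF p, of "real n / \<delta>" x] False \<delta> elim
        by (simp add: D_def field_simps)
      then have "K * tail G (\<delta> * x / n) ^ 2 \<le> K * (D * tail G x) ^ 2"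
        using K(1) by (intro mult_left_mono power_mono) (auto simp: G.tail_bounds)
      then have *: "prob {\<omega> \<in> space M. Y i \<omega> > \<delta> * x / n \<and> Y j \<omega> > \<delta> * x / n} \<le> K * (D * tail G x) ^ 2"
        if "1 \<le> i" "1 \<le> j" "i \<noteq> j" for i j
        using K(2)[OF that, of "\<delta> * x / n"] by linarith
      have "prob {\<omega> \<in> space M. claim_sum n \<omega> > x}
          \<le> real n * tail G ((1 - \<delta>) * x) + real n ^ 2 * (K * (D * tail G x) ^ 2)"
        by (rule sum_tail_upper[OF *]) (use False \<delta> elim in auto)
      also have "\<dots> \<le> real n * (\<eta> * tail G x) + real n ^ 2 * (K * (D * tail G x) ^ 2)"
        using elim K(1) by (intro add_mono mult_left_mono) auto
      also have "\<dots> = (real n * \<eta> + real n ^ 2 * K * D ^ 2 * tail G x) * tail G x"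
        by (simp add: algebra_simps power2_eq_square)
      also have "\<dots> < r * tail G x" using elim pos by (intro mult_strict_right_mono) auto
      finally show ?case using pos[of x] by (simp add: pos_divide_less_eq)
    qed
  qed
qed

end

section \<open>A random number of claims\<close>

lemma (in prob_space) nn_integral_nat_index:
  assumes [measurable]: "\<kappa> \<in> measurable M (count_space UNIV)"
    and fin: "(\<integral>\<^sup>+\<omega>. of_nat (\<kappa> \<omega>) \<partial>M) < \<infinity>"
  shows "summable (\<lambda>n. real n * prob {\<omega> \<in> space M. \<kappa> \<omega> = n})"
    and "(\<integral>\<^sup>+\<omega>. of_nat (\<kappa> \<omega>) \<partial>M) = ennreal (\<Sum>n. real n * prob {\<omega> \<in> space M. \<kappa> \<omega> = n})"
proof -
  let ?A = "\<lambda>n. {\<omega> \<in> space M. \<kappa> \<omega> = n}"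
  have "(\<integral>\<^sup>+\<omega>. of_nat (\<kappa> \<omega>) \<partial>M) = (\<integral>\<^sup>+\<omega>. (\<Sum>n. of_nat n * indicator (?A n) \<omega>) \<partial>M)"
    by (intro nn_integral_cong suminf_cmult_indicator[symmetric]) (auto simp: disjoint_family_on_def)
  also have "\<dots> = (\<Sum>n. \<integral>\<^sup>+\<omega>. of_nat n * indicator (?A n) \<omega> \<partial>M)"
    by (rule nn_integral_suminf) measurable
  also have "\<dots> = (\<Sum>n. ennreal (real n * prob (?A n)))"
    by (intro suminf_cong, subst nn_integral_cmult_indicator)
      (auto simp: emeasure_eq_measure ennreal_mult ennreal_of_nat_eq_real_of_nat)
  finally have eq: "(\<integral>\<^sup>+\<omega>. of_nat (\<kappa> \<omega>) \<partial>M) = (\<Sum>n. ennreal (real n * prob (?A n)))" .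
  show s: "summable (\<lambda>n. real n * prob (?A n))"
    using fin unfolding eq by (intro summable_suminf_not_top) auto
  show "(\<integral>\<^sup>+\<omega>. of_nat (\<kappa> \<omega>) \<partial>M) = ennreal (\<Sum>n. real n * prob (?A n))"
    unfolding eq by (intro suminf_ennreal2 s) auto
qed

lemma (in prob_space) nn_integral_nat_index_tail:
  assumes [measurable]: "\<kappa> \<in> measurable M (count_space UNIV)"
  shows "(\<integral>\<^sup>+\<omega>. of_nat (\<kappa> \<omega>) \<partial>M) = (\<Sum>n. ennreal (prob {\<omega> \<in> space M. \<kappa> \<omega> > n}))"
proof -
  let ?A = "\<lambda>n. {\<omega> \<in> space M. \<kappa> \<omega> > n}"
  have "(\<Sum>n. indicator (?A n) \<omega>) = (of_nat (\<kappa> \<omega>) :: ennreal)" if "\<omega> \<in> space M" for \<omega>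
  proof -
    have "(\<Sum>n. indicator (?A n) \<omega>) = (\<Sum>n<\<kappa> \<omega>. indicator (?A n) \<omega> :: ennreal)"
      by (rule suminf_finite) (auto simp: indicator_def)
    also have "\<dots> = (\<Sum>n<\<kappa> \<omega>. 1)" using that by (intro sum.cong) auto
    finally show ?thesis by simp
  qed
  then have "(\<integral>\<^sup>+\<omega>. of_nat (\<kappa> \<omega>) \<partial>M) = (\<integral>\<^sup>+\<omega>. (\<Sum>n. indicator (?A n) \<omega>) \<partial>M)"
    by (intro nn_integral_cong) simp
  also have "\<dots> = (\<Sum>n. \<integral>\<^sup>+\<omega>. indicator (?A n) \<omega> \<partial>M)"
    by (rule nn_integral_suminf) measurable
  also have "\<dots> = (\<Sum>n. ennreal (prob (?A n)))"
    by (intro suminf_cong, subst nn_integral_indicator) (auto simp: emeasure_eq_measure)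
  finally show ?thesis .
qed

context enod_claims
begin

text \<open>
  The series is at most \<open>1 + \<mu>\<close>, since for each \<open>y \<ge> 0\<close> at most \<open>1 + y\<close> natural numbers lie below \<open>y\<close>.
\<close>

lemma summable_tail: "summable (\<lambda>n. tail G (real n))"
proof (rule bounded_imp_summable)
  show "tail G (real n) \<ge> 0" for n by (rule G.tail_bounds)
  show "(\<Sum>n\<le>m. tail G (real n)) \<le> 1 + (\<integral>y. y \<partial>G)" for m
  proof -
    have pt: "(\<Sum>n<k. indicator {real n<..} y) \<le> min (real k) (1 + y)" if "0 \<le> y" for y :: real and k
    proof (induction k)
      case (Suc k) then show ?case by (cases "real k < y") auto
    qed (use that in auto)
    have ind: "integrable G (indicator {t<..} :: real \<Rightarrow> real)" for t
      by (rule integrable_real_indicator) (auto simp: G.emeasure_eq_measure)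
    have "(\<Sum>n\<le>m. tail G (real n)) = (\<integral>y. (\<Sum>n<Suc m. indicator {real n<..} y) \<partial>G)"
      using ind by (simp add: measure_G_greaterThan lessThan_Suc_atMost)
    also have "\<dots> \<le> (\<integral>y. 1 + y \<partial>G)"
    proof (rule integral_mono_AE)
      show "AE y in G. (\<Sum>n<Suc m. indicator {real n<..} y) \<le> 1 + y"
        using AE_G_nonneg by eventually_elim (use pt[of _ "Suc m"] in fastforce)
    qed (use ind G_integrable in auto)
    also have "\<dots> = 1 + (\<integral>y. y \<partial>G)" using G_integrable G.prob_space by simp
    finally show ?thesis .
  qed
qed

text \<open>
  The tail of the index is eventually below that of \<open>G\<close>, and \<open>G\<close> has a finite mean.
\<close>

lemma index_mean_finite:
  assumes \<kappa>[measurable]: "\<kappa> \<in> measurable M (count_space UNIV)"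
    and small: "(\<lambda>x. prob {\<omega> \<in> space M. real (\<kappa> \<omega>) > x}) \<in> o[at_top](tail G)"
  shows "(\<integral>\<^sup>+\<omega>. of_nat (\<kappa> \<omega>) \<partial>M) < \<infinity>"
proof -
  have "\<forall>\<^sub>F x in at_top. norm (prob {\<omega> \<in> space M. real (\<kappa> \<omega>) > x}) \<le> 1 * norm (tail G x)"
    using landau_o.smallD[OF small, of 1] by simp
  then have "\<forall>\<^sub>F n in sequentially. norm (prob {\<omega> \<in> space M. real (\<kappa> \<omega>) > real n}) \<le> 1 * norm (tail G (real n))"
    by (rule eventually_compose_filterlim[OF _ filterlim_real_sequentially])
  then have "\<forall>\<^sub>F n in sequentially. norm (prob {\<omega> \<in> space M. \<kappa> \<omega> > n}) \<le> tail G (real n)"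
    by eventually_elim (simp add: G.tail_bounds)
  then have "summable (\<lambda>n. prob {\<omega> \<in> space M. \<kappa> \<omega> > n})"
    by (rule summable_comparison_test_ev[OF _ summable_tail])
  then show ?thesis
    unfolding nn_integral_nat_index_tail[OF \<kappa>] by (subst suminf_ennreal2) auto
qed

lemma random_sum_measurable[measurable]:
  assumes [measurable]: "\<kappa> \<in> measurable M (count_space UNIV)"
  shows "(\<lambda>\<omega>. claim_sum (\<kappa> \<omega>) \<omega>) \<in> borel_measurable M"
  by (rule measurable_compose_countable[where g = \<kappa>]) measurable

text \<open>
  The sum over the values of the index is cut at \<open>x / B\<close>. The part below is dominated termwise by the
  summable sequence \<open>C * (n * p n)\<close>, so Tannery's theorem yields its limit; the part above is negligible
  because the tail at \<open>x / B\<close> is comparable with the tail at \<open>x\<close>.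
\<close>

lemma random_sum_tail_upper:
  fixes \<kappa> :: "'a \<Rightarrow> nat"
  defines "p \<equiv> \<lambda>n. prob {\<omega> \<in> space M. \<kappa> \<omega> = n}"
  assumes \<kappa>[measurable]: "\<kappa> \<in> measurable M (count_space UNIV)"
    and indep: "\<And>n x. prob {\<omega> \<in> space M. \<kappa> \<omega> = n \<and> claim_sum n \<omega> > x}
        = p n * prob {\<omega> \<in> space M. claim_sum n \<omega> > x}"
    and small: "(\<lambda>x. prob {\<omega> \<in> space M. real (\<kappa> \<omega>) > x}) \<in> o[at_top](tail G)"
    and summ: "summable (\<lambda>n. real n * p n)"
    and r: "(\<Sum>n. real n * p n) < r"
  shows "\<forall>\<^sub>F x in at_top. prob {\<omega> \<in> space M. claim_sum (\<kappa> \<omega>) \<omega> > x} / tail G x < r"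
proof -
  note pos = consistently_varying_pos[OF G_cv]
  obtain C where C: "C > 0"
    "\<And>n x. n \<ge> 1 \<Longrightarrow> x > 0 \<Longrightarrow> 4 * (\<integral>y. y \<partial>G) * real n \<le> x \<Longrightarrow>
       prob {\<omega> \<in> space M. claim_sum n \<omega> > x} \<le> C * real n * tail G x"
    using uniform_sum_tail_bound by blast
  obtain q :: nat where q: "\<And>u. u \<ge> 0 \<Longrightarrow> tail G (u / 2) \<le> 2 ^ q * tail G u"
    using G.consistently_varying_doubling[OF G_cv] by blast
  \<comment> \<open>For \<open>n \<le> x / B\<close> the uniform bound applies; the summand \<open>1\<close> keeps \<open>B \<ge> 1\<close>, as needed to compare the
    tails at \<open>x / B\<close> and at \<open>x\<close>.\<close>
  define B where "B = 4 * (\<integral>y. y \<partial>G) + 1"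
  have B: "B \<ge> 1" using mean_nonneg by (simp add: B_def)
  define a where "a n x = (if real n \<le> x / B then p n * (prob {\<omega> \<in> space M. claim_sum n \<omega> > x} / tail G x) else 0)"
    for n x
  have p0: "p n \<ge> 0" for n by (simp add: p_def)
  have a_lim: "((\<lambda>x. a n x) \<longlongrightarrow> real n * p n) at_top" for n
  proof (rule Lim_transform_eventually)
    show "((\<lambda>x. p n * (prob {\<omega> \<in> space M. claim_sum n \<omega> > x} / tail G x)) \<longlongrightarrow> real n * p n) at_top"
      using tendsto_mult_left[OF sum_tail_limit[of n], of "p n"] by (simp add: mult.commute)
    show "\<forall>\<^sub>F x in at_top. p n * (prob {\<omega> \<in> space M. claim_sum n \<omega> > x} / tail G x) = a n x"
      using eventually_ge_at_top[of "real n * B"]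
      by eventually_elim (use B in \<open>auto simp: a_def field_simps\<close>)
  qed
  have a_bound: "norm (a n x) \<le> C * (real n * p n)" if x: "x > 0" for n x
  proof (cases "n \<ge> 1 \<and> real n \<le> x / B")
    case True
    then have "real n * B \<le> x" using B by (simp add: field_simps)
    then have "4 * (\<integral>y. y \<partial>G) * real n \<le> x" using True by (simp add: B_def algebra_simps)
    then have "prob {\<omega> \<in> space M. claim_sum n \<omega> > x} / tail G x \<le> C * real n"
      using C(2)[of n x] True x pos[of x] by (simp add: pos_divide_le_eq)
    then have "p n * (prob {\<omega> \<in> space M. claim_sum n \<omega> > x} / tail G x) \<le> p n * (C * real n)"
      using p0 by (intro mult_left_mono)
    then show ?thesis using True p0[of n] less_imp_le[OF pos[of x]] by (simp add: a_def mult_ac)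
  next
    case False
    have "a n x = 0"
    proof (cases "n = 0")
      case True
      then have "{\<omega> \<in> space M. claim_sum n \<omega> > x} = {}" using x by (auto simp: claim_sum_def)
      then show ?thesis unfolding a_def by (simp only: measure_empty) simp
    qed (use False in \<open>auto simp: a_def\<close>)
    then show ?thesis using C(1) p0 by simp
  qed
  have "\<forall>\<^sub>F (n, x) in at_top \<times>\<^sub>F at_top. norm (a n x) \<le> C * (real n * p n)"
    unfolding eventually_prod_filter
    by (rule exI[of _ "\<lambda>_. True"], rule exI[of _ "\<lambda>x. x > 0"])
      (use a_bound eventually_gt_at_top[of 0] in auto)
  from tannerys_theorem[OF a_lim this summable_mult[OF summ]]
  have lim1: "((\<lambda>x. \<Sum>n. a n x) \<longlongrightarrow> (\<Sum>n. real n * p n)) at_top" by simp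
  define e where "e x = prob {\<omega> \<in> space M. real (\<kappa> \<omega>) > x / B} / tail G x" for x
  have lim2: "(e \<longlongrightarrow> 0) at_top"
  proof (rule tendsto_sandwich[OF _ _ tendsto_const])
    show "\<forall>\<^sub>F x in at_top. 0 \<le> e x"
      by (intro always_eventually) (auto simp: e_def G.tail_bounds)
    show "\<forall>\<^sub>F x in at_top. e x \<le> prob {\<omega> \<in> space M. real (\<kappa> \<omega>) > x / B} / tail G (x / B) * (2 * B) ^ q"
      using eventually_ge_at_top[of 0]
    proof eventually_elim
      case (elim x)
      have "tail G (x / B) \<le> (2 * B) ^ q * tail G x" using G.tail_div_le[OF q B elim] .
      then have "1 / tail G x \<le> (2 * B) ^ q / tail G (x / B)"
        using pos[of x] pos[of "x / B"] by (simp add: field_simps)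
      then have "prob {\<omega> \<in> space M. real (\<kappa> \<omega>) > x / B} * (1 / tail G x)
          \<le> prob {\<omega> \<in> space M. real (\<kappa> \<omega>) > x / B} * ((2 * B) ^ q / tail G (x / B))"
        by (intro mult_left_mono) auto
      then show ?case by (simp add: e_def)
    qed
    have "((\<lambda>x. prob {\<omega> \<in> space M. real (\<kappa> \<omega>) > x} / tail G x) \<longlongrightarrow> 0) at_top"
      by (rule smalloD_tendsto[OF small])
    moreover have "filterlim (\<lambda>x. x / B) at_top at_top"
      using B filterlim_tendsto_pos_mult_at_top[OF tendsto_const[of "1 / B"] _ filterlim_ident] by simp
    ultimately have "((\<lambda>x. prob {\<omega> \<in> space M. real (\<kappa> \<omega>) > x / B} / tail G (x / B)) \<longlongrightarrow> 0) at_top"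
      by (rule filterlim_compose)
    then show "((\<lambda>x. prob {\<omega> \<in> space M. real (\<kappa> \<omega>) > x / B} / tail G (x / B) * (2 * B) ^ q) \<longlongrightarrow> 0) at_top"
      by (rule tendsto_mult_left_zero)
  qed
  have "\<forall>\<^sub>F x in at_top. (\<Sum>n. a n x) + e x < r"
    using tendsto_add[OF lim1 lim2] r by (intro order_tendstoD) auto
  then show ?thesis using eventually_gt_at_top[of 0]
  proof eventually_elim
    case (elim x)
    let ?I = "{n. real n \<le> x / B}"
    have fin: "finite ?I"
    proof (rule finite_subset)
      show "?I \<subseteq> {..nat \<lfloor>x / B\<rfloor>}" by (auto simp: le_nat_floor)
    qed simp
    let ?E = "\<lambda>n. {\<omega> \<in> space M. \<kappa> \<omega> = n \<and> claim_sum n \<omega> > x}"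
    have "{\<omega> \<in> space M. claim_sum (\<kappa> \<omega>) \<omega> > x}
        \<subseteq> (\<Union>n\<in>?I. ?E n) \<union> {\<omega> \<in> space M. real (\<kappa> \<omega>) > x / B}" by auto
    then have "prob {\<omega> \<in> space M. claim_sum (\<kappa> \<omega>) \<omega> > x}
        \<le> prob ((\<Union>n\<in>?I. ?E n) \<union> {\<omega> \<in> space M. real (\<kappa> \<omega>) > x / B})"
      by (rule finite_measure_mono) (intro sets.Un sets.finite_UN fin, measurable)
    also have "\<dots> \<le> prob (\<Union>n\<in>?I. ?E n) + prob {\<omega> \<in> space M. real (\<kappa> \<omega>) > x / B}"
      by (rule measure_Un_le) (intro sets.finite_UN fin, measurable)
    also have "prob (\<Union>n\<in>?I. ?E n) \<le> (\<Sum>n\<in>?I. prob (?E n))"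
      by (rule measure_UNION_le[OF fin]) measurable
    also have "\<dots> = (\<Sum>n\<in>?I. a n x * tail G x)"
      using pos[of x] by (intro sum.cong refl) (simp add: indep a_def)
    also have "\<dots> = (\<Sum>n\<in>?I. a n x) * tail G x" by (simp add: sum_distrib_right)
    also have "(\<Sum>n\<in>?I. a n x) = (\<Sum>n. a n x)"
      by (rule suminf_finite[symmetric]) (use fin in \<open>auto simp: a_def\<close>)
    also have "prob {\<omega> \<in> space M. real (\<kappa> \<omega>) > x / B} = e x * tail G x"
      using pos[of x] by (simp add: e_def)
    also have "(\<Sum>n. a n x) * tail G x + e x * tail G x = ((\<Sum>n. a n x) + e x) * tail G x"
      by (simp add: algebra_simps)
    also have "\<dots> < r * tail G x" using elim pos by (intro mult_strict_right_mono) auto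
    finally show ?case using pos[of x] by (simp add: pos_divide_less_eq)
  qed
qed

text \<open>
  Finitely many values \<open>n < m\<close> of the index already give more than \<open>r\<close>, and still do after a restriction
  to the event that the deduction \<open>W n\<close> is at most a large constant \<open>A\<close>. On that event a single claim
  above \<open>x + A\<close> suffices, and the shift by \<open>A\<close> does not matter asymptotically.
\<close>

lemma random_sum_tail_lower:
  fixes \<kappa> :: "'a \<Rightarrow> nat" and W :: "nat \<Rightarrow> 'a \<Rightarrow> real"
  defines "p \<equiv> \<lambda>n. prob {\<omega> \<in> space M. \<kappa> \<omega> = n}"
  assumes \<kappa>[measurable]: "\<kappa> \<in> measurable M (count_space UNIV)"
    and W[measurable]: "\<And>n. W n \<in> borel_measurable M"
    and indep: "\<And>n b x. prob {\<omega> \<in> space M. \<kappa> \<omega> = n \<and> W n \<omega> \<le> b \<and> (\<exists>i\<in>{1..n}. Y i \<omega> > x)}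
        = prob {\<omega> \<in> space M. \<kappa> \<omega> = n \<and> W n \<omega> \<le> b} * prob {\<omega> \<in> space M. \<exists>i\<in>{1..n}. Y i \<omega> > x}"
    and summ: "summable (\<lambda>n. real n * p n)"
    and r: "r < (\<Sum>n. real n * p n)"
  shows "\<forall>\<^sub>F x in at_top. r < prob {\<omega> \<in> space M. claim_sum (\<kappa> \<omega>) \<omega> - W (\<kappa> \<omega>) \<omega> > x} / tail G x"
proof -
  note pos = consistently_varying_pos[OF G_cv]
  have "\<forall>\<^sub>F m in sequentially. r < (\<Sum>n<m. real n * p n)"
    by (rule order_tendstoD(1)[OF summable_LIMSEQ[OF summ] r])
  then obtain m where m: "r < (\<Sum>n<m. real n * p n)"
    by (auto simp: eventually_sequentially)
  define Q where "Q n k = prob {\<omega> \<in> space M. \<kappa> \<omega> = n \<and> W n \<omega> \<le> real k}" for n k :: nat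
  have "(\<lambda>k. Q n k) \<longlonglongrightarrow> p n" for n
  proof -
    have "(\<lambda>k. prob {\<omega> \<in> space M. \<kappa> \<omega> = n \<and> W n \<omega> \<le> real k})
        \<longlonglongrightarrow> prob (\<Union>k. {\<omega> \<in> space M. \<kappa> \<omega> = n \<and> W n \<omega> \<le> real k})"
      by (rule finite_Lim_measure_incseq) (auto simp: incseq_def)
    also have "(\<Union>k. {\<omega> \<in> space M. \<kappa> \<omega> = n \<and> W n \<omega> \<le> real k}) = {\<omega> \<in> space M. \<kappa> \<omega> = n}"
      using real_arch_simple by auto
    finally show ?thesis by (simp add: Q_def p_def)
  qed
  then have "(\<lambda>k. \<Sum>n<m. real n * Q n k) \<longlonglongrightarrow> (\<Sum>n<m. real n * p n)"
    by (intro tendsto_intros)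
  from order_tendstoD(1)[OF this m]
  obtain k where k: "r < (\<Sum>n<m. real n * Q n k)"
    by (auto simp: eventually_sequentially)
  define A where "A = real k"
  have shift: "filterlim (\<lambda>x. x + A) at_top at_top"
    by (rule filterlim_tendsto_add_at_top[OF tendsto_const filterlim_ident, of A, unfolded add.commute[of A]])
  let ?X = "\<lambda>n x. {\<omega> \<in> space M. \<exists>i\<in>{1..n}. Y i \<omega> > x}"
  have "((\<lambda>x. Q n k * (prob (?X n (x + A)) / tail G (x + A) * (tail G (x + A) / tail G x)))
      \<longlongrightarrow> Q n k * (real n * 1)) at_top" for n
    by (intro tendsto_intros G.tail_shift_ratio[OF G_cv] filterlim_compose[OF max_tail_limit shift])
      (simp add: A_def)
  then have "((\<lambda>x. \<Sum>n<m. Q n k * (prob (?X n (x + A)) / tail G (x + A) * (tail G (x + A) / tail G x)))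
      \<longlongrightarrow> (\<Sum>n<m. Q n k * (real n * 1))) at_top"
    by (intro tendsto_sum)
  then have "\<forall>\<^sub>F x in at_top. r < (\<Sum>n<m. Q n k * (prob (?X n (x + A)) / tail G (x + A) * (tail G (x + A) / tail G x)))"
    using k by (intro order_tendstoD) (simp add: mult.commute)
  then show ?thesis
  proof eventually_elim
    case (elim x)
    let ?E = "\<lambda>n. {\<omega> \<in> space M. \<kappa> \<omega> = n \<and> W n \<omega> \<le> A \<and> (\<exists>i\<in>{1..n}. Y i \<omega> > x + A)}"
    have [measurable]: "(\<lambda>\<omega>. W (\<kappa> \<omega>) \<omega>) \<in> borel_measurable M"
      by (rule measurable_compose_countable[where g = \<kappa>]) measurable
    have "(\<Sum>n<m. Q n k * (prob (?X n (x + A)) / tail G (x + A) * (tail G (x + A) / tail G x)))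
        = (\<Sum>n<m. prob (?E n) / tail G x)"
      unfolding indep Q_def A_def using pos by (intro sum.cong refl) (simp add: less_imp_neq[symmetric])
    also have "\<dots> = (\<Sum>n<m. prob (?E n)) / tail G x" by (simp add: sum_divide_distrib)
    also have "(\<Sum>n<m. prob (?E n)) = prob (\<Union>n<m. ?E n)"
      by (rule finite_measure_finite_Union[symmetric]) (auto simp: disjoint_family_on_def)
    also have "\<dots> \<le> prob {\<omega> \<in> space M. claim_sum (\<kappa> \<omega>) \<omega> - W (\<kappa> \<omega>) \<omega> > x}"
    proof (rule finite_measure_mono_AE)
      show "AE \<omega> in M. \<omega> \<in> (\<Union>n<m. ?E n) \<longrightarrow> \<omega> \<in> {\<omega> \<in> space M. claim_sum (\<kappa> \<omega>) \<omega> - W (\<kappa> \<omega>) \<omega> > x}"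
        using AE_claims_nonneg
      proof eventually_elim
        case (elim \<omega>)
        have "Y i \<omega> \<le> claim_sum n \<omega>" if "i \<in> {1..n}" for i n
          unfolding claim_sum_def using that elim by (intro member_le_sum) auto
        then show ?case by fastforce
      qed
    qed measurable
    finally show ?case using elim pos[of x]
      by (meson divide_right_mono less_imp_le less_le_trans)
  qed
qed

end

section \<open>The renewal risk model\<close>

lemma arrival_time_measurable:
  assumes "\<And>i. i \<ge> 1 \<Longrightarrow> Z i \<in> borel_measurable F"
  shows "arrival_time Z n \<in> borel_measurable F"
  unfolding arrival_time_def[abs_def] using assms by (intro borel_measurable_sum) auto

lemma renewal_count_measurable:
  assumes "\<And>i. i \<ge> 1 \<Longrightarrow> Z i \<in> borel_measurable F" and [measurable]: "T \<in> borel_measurable F"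
  shows "(\<lambda>\<omega>. renewal_count Z (T \<omega>) \<omega>) \<in> borel_measurable F"
proof -
  note [measurable] = arrival_time_measurable[OF assms(1)]
  have "indicator {..T \<omega>} (arrival_time Z (Suc n) \<omega>)
      = (indicator {\<omega>. arrival_time Z (Suc n) \<omega> \<le> T \<omega>} \<omega> :: ennreal)" for n \<omega>
    by (auto simp: indicator_def)
  then show ?thesis unfolding renewal_count_def by simp
qed

text \<open>
  The number of arrivals as a natural number. It agrees with \<open>renewal_count\<close> where that is finite;
  elsewhere it is \<open>0\<close>, the value of \<open>enn2real\<close> at infinity.
\<close>

definition renewal_number :: "(nat \<Rightarrow> 'a \<Rightarrow> real) \<Rightarrow> real \<Rightarrow> 'a \<Rightarrow> nat" where
  "renewal_number Z t \<omega> = nat \<lfloor>enn2real (renewal_count Z t \<omega>)\<rfloor>"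

lemma renewal_count_eq_number:
  "renewal_count Z t \<omega> = \<infinity> \<or> renewal_count Z t \<omega> = of_nat (renewal_number Z t \<omega>)"
proof -
  let ?S = "{n. arrival_time Z (Suc n) \<omega> \<le> t}"
  have eq: "renewal_count Z t \<omega> = (\<Sum>n. indicator ?S n)"
    unfolding renewal_count_def by (intro suminf_cong) (auto simp: indicator_def)
  also have "\<dots> = (\<integral>\<^sup>+n. indicator ?S n \<partial>count_space UNIV)"
    by (rule nn_integral_count_space_nat[symmetric])
  also have "\<dots> = emeasure (count_space UNIV) ?S"
    by (rule nn_integral_indicator) simp
  finally have eq: "renewal_count Z t \<omega> = emeasure (count_space UNIV) ?S" .
  show ?thesis
  proof (cases "finite ?S")
    case True
    then have "renewal_count Z t \<omega> = of_nat (card ?S)" using eq by simp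
    moreover from this have "renewal_number Z t \<omega> = card ?S"
      by (simp add: renewal_number_def ennreal_of_nat_eq_real_of_nat)
    ultimately show ?thesis by simp
  qed (use eq in auto)
qed

lemma renewal_number_measurable:
  assumes "\<And>i. i \<ge> 1 \<Longrightarrow> Z i \<in> borel_measurable F" and "T \<in> borel_measurable F"
  shows "(\<lambda>\<omega>. renewal_number Z (T \<omega>) \<omega>) \<in> measurable F (count_space UNIV)"
proof -
  note [measurable] = renewal_count_measurable[OF assms]
  show ?thesis unfolding renewal_number_def by measurable
qed

text \<open>
  The \<open>\<sigma>\<close>-algebra generated by the whole sequence, as a measure space in which measurability of events
  can be proved by the usual means.
\<close>

abbreviation gen_algebra :: "'a measure \<Rightarrow> (nat \<Rightarrow> 'a \<Rightarrow> real) \<Rightarrow> 'a measure" where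
  "gen_algebra M X \<equiv> vimage_algebra (space M) (seq_rv X) seq_space"

lemma seq_rv_in_space: "seq_rv X \<in> S \<rightarrow> space seq_space"
  by (auto simp: seq_rv_def seq_space_def space_PiM)

lemma gen_algebra_component:
  assumes "i \<ge> 1"
  shows "X i \<in> borel_measurable (gen_algebra M X)"
proof -
  have "(\<lambda>f. f i) \<in> borel_measurable seq_space"
    using assms unfolding seq_space_def by (intro measurable_component_singleton) simp
  moreover have "seq_rv X \<in> measurable (gen_algebra M X) seq_space"
    by (rule measurable_vimage_algebra1[OF seq_rv_in_space])
  ultimately have "(\<lambda>\<omega>. seq_rv X \<omega> i) \<in> borel_measurable (gen_algebra M X)"
    by (rule measurable_compose_rev)
  then show ?thesis using assms by (simp add: seq_rv_def)
qed

locale ruin_model = enod_claims M Y G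
  for M :: "'a measure" and Y :: "nat \<Rightarrow> 'a \<Rightarrow> real" and G :: "real measure" +
  fixes Z :: "nat \<Rightarrow> 'a \<Rightarrow> real" and c :: real and \<tau> :: "'a \<Rightarrow> nat"
  assumes Z_measurable[measurable]: "\<And>i. i \<ge> 1 \<Longrightarrow> Z i \<in> borel_measurable M"
    and Z_nonneg: "AE \<omega> in M. \<forall>i\<ge>1. 0 \<le> Z i \<omega>"
    and YZ_indep: "indep_rv M seq_space (seq_rv Y) seq_space (seq_rv Z)"
    and c_pos: "c > 0"
    and \<tau>_measurable[measurable]: "\<tau> \<in> measurable M (count_space UNIV)"
    and \<tau>_indep: "indep_rv M (count_space UNIV) \<tau>
           (seq_space \<Otimes>\<^sub>M seq_space) (\<lambda>\<omega>. (seq_rv Y \<omega>, seq_rv Z \<omega>))"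
begin

text \<open>
  Pairwise independence of \<open>\<tau>\<close> from the pair and of \<open>Y\<close> from \<open>Z\<close> makes the three independent.
\<close>

lemma indep_three:
  assumes B: "B \<in> sets (gen_algebra M Z)" and A: "A \<in> sets (gen_algebra M Y)"
  shows "prob ({\<omega> \<in> space M. \<tau> \<omega> = t} \<inter> B \<inter> A) = prob {\<omega> \<in> space M. \<tau> \<omega> = t} * prob B * prob A"
proof -
  let ?P = "vimage_algebra (space M) (\<lambda>\<omega>. (seq_rv Y \<omega>, seq_rv Z \<omega>)) (seq_space \<Otimes>\<^sub>M seq_space)"
  have m: "(\<lambda>\<omega>. (seq_rv Y \<omega>, seq_rv Z \<omega>)) \<in> measurable ?P (seq_space \<Otimes>\<^sub>M seq_space)"
    by (rule measurable_vimage_algebra1) (auto simp: space_pair_measure intro: seq_rv_in_space[THEN funcset_mem])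
  from measurable_compose[OF m measurable_fst] have "seq_rv Y \<in> measurable ?P seq_space" by simp
  then have "A \<in> sets ?P"
    using A by (auto simp: sets_vimage_algebra2[OF seq_rv_in_space] dest: measurable_sets)
  moreover from measurable_compose[OF m measurable_snd] have "seq_rv Z \<in> measurable ?P seq_space" by simp
  then have "B \<in> sets ?P"
    using B by (auto simp: sets_vimage_algebra2[OF seq_rv_in_space] dest: measurable_sets)
  moreover have "{\<omega> \<in> space M. \<tau> \<omega> = t} \<in> sets (vimage_algebra (space M) \<tau> (count_space UNIV))"
    by (subst sets_vimage_algebra2) (auto intro!: exI[of _ "{t}"])
  ultimately have "prob ({\<omega> \<in> space M. \<tau> \<omega> = t} \<inter> (B \<inter> A)) = prob {\<omega> \<in> space M. \<tau> \<omega> = t} * prob (B \<inter> A)"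
    using \<tau>_indep unfolding indep_rv_def by (intro indep_setD) auto
  moreover have "prob (A \<inter> B) = prob A * prob B"
    using YZ_indep A B unfolding indep_rv_def by (intro indep_setD)
  ultimately show ?thesis by (simp add: Int_ac mult_ac)
qed

lemma gen_algebra_Z_subset: "B \<in> sets (gen_algebra M Z) \<Longrightarrow> B \<in> events"
  and gen_algebra_Y_subset: "A \<in> sets (gen_algebra M Y) \<Longrightarrow> A \<in> events"
  using YZ_indep unfolding indep_rv_def indep_set_def indep_sets_def
  by (auto simp: subset_eq split: bool.splits)

text \<open>
  Splitting by the countably many values of \<open>\<tau>\<close> shows that the pair \<open>(\<tau>, Z)\<close> is independent of \<open>Y\<close>.
\<close>

lemma indep_time_changed:
  assumes D: "\<And>t. {\<omega> \<in> space M. P t \<omega>} \<in> sets (gen_algebra M Z)"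
    and A: "{\<omega> \<in> space M. Q \<omega>} \<in> sets (gen_algebra M Y)"
  shows "prob {\<omega> \<in> space M. P (\<tau> \<omega>) \<omega> \<and> Q \<omega>} = prob {\<omega> \<in> space M. P (\<tau> \<omega>) \<omega>} * prob {\<omega> \<in> space M. Q \<omega>}"
proof -
  let ?T = "\<lambda>t. {\<omega> \<in> space M. \<tau> \<omega> = t}" and ?D = "\<lambda>t. {\<omega> \<in> space M. P t \<omega>}" and ?Q = "{\<omega> \<in> space M. Q \<omega>}"
  have S: "space M \<in> sets (gen_algebra M Y)"
    by (metis sets.top space_vimage_algebra)
  note [measurable] = gen_algebra_Z_subset[OF D] gen_algebra_Y_subset[OF A]
  have sums: "(\<lambda>t. prob (?T t \<inter> ?D t \<inter> B)) sums prob (\<Union>t. ?T t \<inter> ?D t \<inter> B)" if "B \<in> events" for B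
    using that by (intro finite_measure_UNION) (auto simp: disjoint_family_on_def)
  have "(\<lambda>t. prob (?T t \<inter> ?D t \<inter> ?Q)) sums prob (\<Union>t. ?T t \<inter> ?D t \<inter> ?Q)"
    by (rule sums) measurable
  also have "(\<lambda>t. prob (?T t \<inter> ?D t \<inter> ?Q)) = (\<lambda>t. prob (?T t \<inter> ?D t \<inter> space M) * prob ?Q)"
    unfolding indep_three[OF D A] indep_three[OF D S] prob_space by simp
  finally have 1: "(\<lambda>t. prob (?T t \<inter> ?D t \<inter> space M) * prob ?Q) sums prob (\<Union>t. ?T t \<inter> ?D t \<inter> ?Q)" .
  have "(\<lambda>t. prob (?T t \<inter> ?D t \<inter> space M) * prob ?Q) sums (prob (\<Union>t. ?T t \<inter> ?D t \<inter> space M) * prob ?Q)"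
    by (intro sums_mult2 sums) measurable
  from sums_unique2[OF 1 this]
  have "prob (\<Union>t. ?T t \<inter> ?D t \<inter> ?Q) = prob (\<Union>t. ?T t \<inter> ?D t \<inter> space M) * prob ?Q" .
  moreover have "(\<Union>t. ?T t \<inter> ?D t \<inter> ?Q) = {\<omega> \<in> space M. P (\<tau> \<omega>) \<omega> \<and> Q \<omega>}" by auto
  moreover have "(\<Union>t. ?T t \<inter> ?D t \<inter> space M) = {\<omega> \<in> space M. P (\<tau> \<omega>) \<omega>}" by auto
  ultimately show ?thesis by simp
qed

lemma count_at_\<tau>_measurable[measurable]: "(\<lambda>\<omega>. renewal_count Z (real (\<tau> \<omega>)) \<omega>) \<in> borel_measurable M"
  by (rule renewal_count_measurable) measurable

text \<open>
  Fubini for the independent pair \<open>(\<tau>, Z)\<close>, carried out termwise over the values of \<open>\<tau>\<close> and the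
  arrivals.
\<close>

lemma renewal_mean_at_\<tau>:
  "(\<integral>\<^sup>+\<omega>. renewal_mean M Z (real (\<tau> \<omega>)) \<partial>M) = (\<integral>\<^sup>+\<omega>. renewal_count Z (real (\<tau> \<omega>)) \<omega> \<partial>M)"
proof -
  let ?T = "\<lambda>t. {\<omega> \<in> space M. \<tau> \<omega> = t}"
  have split: "(\<integral>\<^sup>+\<omega>. f (\<tau> \<omega>) \<omega> \<partial>M) = (\<Sum>t. \<integral>\<^sup>+\<omega>. f t \<omega> * indicator (?T t) \<omega> \<partial>M)"
    if [measurable]: "\<And>t. f t \<in> borel_measurable M" for f :: "nat \<Rightarrow> 'a \<Rightarrow> ennreal"
  proof -
    have "(\<integral>\<^sup>+\<omega>. f (\<tau> \<omega>) \<omega> \<partial>M) = (\<integral>\<^sup>+\<omega>. (\<Sum>t. f t \<omega> * indicator (?T t) \<omega>) \<partial>M)"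
      by (intro nn_integral_cong suminf_cmult_indicator[symmetric]) (auto simp: disjoint_family_on_def)
    also have "\<dots> = (\<Sum>t. \<integral>\<^sup>+\<omega>. f t \<omega> * indicator (?T t) \<omega> \<partial>M)"
      by (rule nn_integral_suminf) measurable
    finally show ?thesis .
  qed
  note [measurable] = arrival_time_measurable[OF Z_measurable] renewal_count_measurable[OF Z_measurable]
  let ?B = "\<lambda>n t. {\<omega> \<in> space M. arrival_time Z (Suc n) \<omega> \<le> real t}"
  have "(\<integral>\<^sup>+\<omega>. renewal_count Z (real t) \<omega> * indicator (?T t) \<omega> \<partial>M)
      = (\<integral>\<^sup>+\<omega>. renewal_mean M Z (real t) * indicator (?T t) \<omega> \<partial>M)" for t
  proof -
    have B: "?B n t \<in> sets (gen_algebra M Z)" for n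
    proof -
      have [measurable]: "arrival_time Z (Suc n) \<in> borel_measurable (gen_algebra M Z)"
        by (intro arrival_time_measurable gen_algebra_component)
      have "{\<omega> \<in> space (gen_algebra M Z). arrival_time Z (Suc n) \<omega> \<le> real t} \<in> sets (gen_algebra M Z)"
        by measurable
      then show ?thesis by simp
    qed
    have Y: "space M \<in> sets (gen_algebra M Y)"
      by (metis sets.top space_vimage_algebra)
    have TB: "emeasure M (?T t \<inter> ?B n t) = emeasure M (?B n t) * emeasure M (?T t)" for n
      using indep_three[OF B[of n] Y, of t] 
      by (simp add: emeasure_eq_measure ennreal_mult[symmetric] prob_space mult.commute Int_absorb2 Int_assoc)
    have N: "renewal_count Z (real t) \<omega> = (\<Sum>n. indicator (?B n t) \<omega>)" if "\<omega> \<in> space M" for \<omega>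
      unfolding renewal_count_def using that by (intro suminf_cong) (auto simp: indicator_def)
    have "(\<integral>\<^sup>+\<omega>. renewal_count Z (real t) \<omega> * indicator (?T t) \<omega> \<partial>M)
        = (\<integral>\<^sup>+\<omega>. (\<Sum>n. indicator (?T t \<inter> ?B n t) \<omega>) \<partial>M)"
      by (intro nn_integral_cong) (auto simp: N indicator_def)
    also have "\<dots> = (\<Sum>n. emeasure M (?T t \<inter> ?B n t))"
      by (subst nn_integral_suminf) auto
    also have "\<dots> = (\<Sum>n. emeasure M (?B n t)) * emeasure M (?T t)"
      unfolding TB by (rule ennreal_suminf_multc)
    also have "(\<Sum>n. emeasure M (?B n t)) = (\<integral>\<^sup>+\<omega>. (\<Sum>n. indicator (?B n t) \<omega>) \<partial>M)"
      by (subst nn_integral_suminf) auto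
    also have "\<dots> = renewal_mean M Z (real t)"
      unfolding renewal_mean_def by (intro nn_integral_cong) (simp add: N)
    also have "renewal_mean M Z (real t) * emeasure M (?T t)
        = (\<integral>\<^sup>+\<omega>. renewal_mean M Z (real t) * indicator (?T t) \<omega> \<partial>M)"
      by (rule nn_integral_cmult_indicator[symmetric]) measurable
    finally show ?thesis .
  qed
  then show ?thesis by (subst (1 2) split) simp_all
qed

definition claim_number :: "'a \<Rightarrow> nat" where
  "claim_number \<omega> = renewal_number Z (real (\<tau> \<omega>)) \<omega>"

lemma claim_number_measurable[measurable]: "claim_number \<in> measurable M (count_space UNIV)"
  unfolding claim_number_def[abs_def] by (rule renewal_number_measurable) measurable

definition income :: "nat \<Rightarrow> 'a \<Rightarrow> real" where
  "income n \<omega> = c * (\<Sum>i=1..n. Z i \<omega>)"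

lemma income_measurable[measurable]: "income n \<in> borel_measurable M"
  unfolding income_def by measurable

lemma net_loss_eq: "net_loss Y Z c n \<omega> = claim_sum n \<omega> - income n \<omega>"
  unfolding net_loss_def claim_sum_def income_def sum_subtractf sum_distrib_left ..

lemma renewal_count_eq_claim_number:
  "renewal_count Z (real (\<tau> \<omega>)) \<omega> < \<infinity> \<Longrightarrow> renewal_count Z (real (\<tau> \<omega>)) \<omega> = of_nat (claim_number \<omega>)"
  using renewal_count_eq_number[of Z "real (\<tau> \<omega>)" \<omega>] by (auto simp: claim_number_def)

lemma indep_claim_number:
  assumes "{\<omega> \<in> space M. Q \<omega>} \<in> sets (gen_algebra M Y)"
  shows "prob {\<omega> \<in> space M. (claim_number \<omega> = n \<and> income n \<omega> \<le> b) \<and> Q \<omega>}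
      = prob {\<omega> \<in> space M. claim_number \<omega> = n \<and> income n \<omega> \<le> b} * prob {\<omega> \<in> space M. Q \<omega>}"
    and "prob {\<omega> \<in> space M. claim_number \<omega> = n \<and> Q \<omega>}
      = prob {\<omega> \<in> space M. claim_number \<omega> = n} * prob {\<omega> \<in> space M. Q \<omega>}"
proof -
  let ?F = "gen_algebra M Z"
  have [measurable]: "\<And>i. i \<ge> 1 \<Longrightarrow> Z i \<in> borel_measurable ?F"
    by (rule gen_algebra_component)
  have [measurable]: "renewal_number Z (real t) \<in> measurable ?F (count_space UNIV)" for t :: nat
    by (rule renewal_number_measurable) measurable
  have [measurable]: "income n \<in> borel_measurable ?F"
    unfolding income_def by measurable
  have sp: "space ?F = space M" by simp
  have "{\<omega> \<in> space ?F. renewal_number Z (real t) \<omega> = n} \<in> sets ?F" for t :: nat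
    by measurable
  then have 1: "{\<omega> \<in> space M. renewal_number Z (real t) \<omega> = n} \<in> sets ?F" for t :: nat
    unfolding sp .
  have "{\<omega> \<in> space ?F. renewal_number Z (real t) \<omega> = n \<and> income n \<omega> \<le> b} \<in> sets ?F" for t :: nat
    by measurable
  then have 2: "{\<omega> \<in> space M. renewal_number Z (real t) \<omega> = n \<and> income n \<omega> \<le> b} \<in> sets ?F" for t :: nat
    unfolding sp .
  show "prob {\<omega> \<in> space M. (claim_number \<omega> = n \<and> income n \<omega> \<le> b) \<and> Q \<omega>}
      = prob {\<omega> \<in> space M. claim_number \<omega> = n \<and> income n \<omega> \<le> b} * prob {\<omega> \<in> space M. Q \<omega>}"
    unfolding claim_number_def by (rule indep_time_changed[OF 2 assms])
  show "prob {\<omega> \<in> space M. claim_number \<omega> = n \<and> Q \<omega>}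
      = prob {\<omega> \<in> space M. claim_number \<omega> = n} * prob {\<omega> \<in> space M. Q \<omega>}"
    unfolding claim_number_def by (rule indep_time_changed[OF 1 assms])
qed

lemma ruin_event_iff:
  assumes "renewal_count Z (real (\<tau> \<omega>)) \<omega> < \<infinity>"
  shows "(SUP n\<in>{n. of_nat n \<le> renewal_count Z (real (\<tau> \<omega>)) \<omega>}. ereal (net_loss Y Z c n \<omega>)) > ereal x
    \<longleftrightarrow> (\<exists>n\<le>claim_number \<omega>. net_loss Y Z c n \<omega> > x)"
  unfolding renewal_count_eq_claim_number[OF assms] by (auto simp: less_SUP_iff)

lemma ruin_event_measurable:
  "{\<omega> \<in> space M. (SUP n\<in>{n. of_nat n \<le> renewal_count Z (real (\<tau> \<omega>)) \<omega>}. ereal (net_loss Y Z c n \<omega>)) > ereal x} \<in> events"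
proof -
  have [measurable]: "net_loss Y Z c n \<in> borel_measurable M" for n
    unfolding net_loss_def by measurable
  show ?thesis by (simp add: less_SUP_iff)
qed

text \<open>
  Premiums only reduce the loss, and the claim sums increase with the number of claims.
\<close>

lemma ruin_prob_le:
  assumes fin: "AE \<omega> in M. renewal_count Z (real (\<tau> \<omega>)) \<omega> < \<infinity>"
  shows "ruin_prob M Y Z c \<tau> x \<le> prob {\<omega> \<in> space M. claim_sum (claim_number \<omega>) \<omega> > x}"
  unfolding ruin_prob_def
proof (rule finite_measure_mono_AE)
  show "AE \<omega> in M. \<omega> \<in> {\<omega> \<in> space M. ereal x < (SUP n\<in>{n. of_nat n \<le> renewal_count Z (real (\<tau> \<omega>)) \<omega>}. ereal (net_loss Y Z c n \<omega>))}
      \<longrightarrow> \<omega> \<in> {\<omega> \<in> space M. claim_sum (claim_number \<omega>) \<omega> > x}"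
    using fin AE_claims_nonneg Z_nonneg
  proof eventually_elim
    case (elim \<omega>)
    have "net_loss Y Z c n \<omega> \<le> claim_sum (claim_number \<omega>) \<omega>" if "n \<le> claim_number \<omega>" for n
    proof -
      have "income n \<omega> \<ge> 0"
        unfolding income_def using elim c_pos by (intro mult_nonneg_nonneg sum_nonneg) auto
      moreover have "claim_sum n \<omega> \<le> claim_sum (claim_number \<omega>) \<omega>"
        unfolding claim_sum_def using elim that by (intro sum_mono2) auto
      ultimately show ?thesis by (simp add: net_loss_eq)
    qed
    then show ?case by (force simp: ruin_event_iff[OF elim(1)])
  qed
qed measurable

text \<open>
  It is enough to look at the last arrival.
\<close>

lemma ruin_prob_ge:
  assumes fin: "AE \<omega> in M. renewal_count Z (real (\<tau> \<omega>)) \<omega> < \<infinity>"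
  shows "prob {\<omega> \<in> space M. claim_sum (claim_number \<omega>) \<omega> - income (claim_number \<omega>) \<omega> > x}
    \<le> ruin_prob M Y Z c \<tau> x"
  unfolding ruin_prob_def
proof (rule finite_measure_mono_AE[OF _ ruin_event_measurable])
  show "AE \<omega> in M. \<omega> \<in> {\<omega> \<in> space M. claim_sum (claim_number \<omega>) \<omega> - income (claim_number \<omega>) \<omega> > x} \<longrightarrow>
      \<omega> \<in> {\<omega> \<in> space M. ereal x < (SUP n\<in>{n. of_nat n \<le> renewal_count Z (real (\<tau> \<omega>)) \<omega>}. ereal (net_loss Y Z c n \<omega>))}"
    using fin
  proof eventually_elim
    case (elim \<omega>)
    show ?case
      unfolding mem_Collect_eq ruin_event_iff[OF elim] unfolding net_loss_eq by blast
  qed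
qed

text \<open>
  Infinitely many arrivals make the count exceed every level, so the probability of this is at most
  \<open>tail G x\<close> for all large \<open>x\<close>.
\<close>

lemma count_finite:
  assumes small: "(\<lambda>x. prob {\<omega> \<in> space M. renewal_count Z (real (\<tau> \<omega>)) \<omega> > ennreal x}) \<in> o[at_top](tail G)"
  shows "AE \<omega> in M. renewal_count Z (real (\<tau> \<omega>)) \<omega> < \<infinity>"
proof -
  let ?I = "{\<omega> \<in> space M. renewal_count Z (real (\<tau> \<omega>)) \<omega> = \<infinity>}"
  have ev: "\<forall>\<^sub>F x in at_top. prob ?I \<le> tail G x"
    using landau_o.smallD[OF small, of 1, OF zero_less_one]
  proof eventually_elim
    case (elim x)
    have "prob ?I \<le> prob {\<omega> \<in> space M. renewal_count Z (real (\<tau> \<omega>)) \<omega> > ennreal x}"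
      by (rule finite_measure_mono) (auto simp: less_top[symmetric])
    then show ?case using elim by (simp add: G.tail_bounds)
  qed
  have "prob ?I \<le> 0"
    by (rule tendsto_lowerbound[OF G.tail_tendsto_0 ev]) simp
  then have "?I \<in> null_sets M"
    by (intro null_setsI) (auto simp: emeasure_eq_measure measure_le_0_iff)
  then have "AE \<omega> in M. \<omega> \<notin> ?I" by (rule AE_not_in)
  with AE_space show ?thesis by eventually_elim (auto simp: less_top)
qed

text \<open>
  The two random sum estimates give convergence of the ratio to \<open>E N\<close>. If \<open>E N = 0\<close>, the ratio with the
  claimed equivalent is meaningless; then almost surely there are no claims up to time \<open>\<tau>\<close>, and both
  sides vanish for \<open>x \<ge> 0\<close>.
\<close>

lemma ruin_prob_asymptotics:
  assumes small: "(\<lambda>x. prob {\<omega> \<in> space M. renewal_count Z (real (\<tau> \<omega>)) \<omega> > ennreal x}) \<in> o[at_top](tail G)"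
  shows "(\<integral>\<^sup>+\<omega>. renewal_mean M Z (real (\<tau> \<omega>)) \<partial>M) < \<infinity>"
    and "ruin_prob M Y Z c \<tau> \<sim>[at_top]
      (\<lambda>x. enn2real (\<integral>\<^sup>+\<omega>. renewal_mean M Z (real (\<tau> \<omega>)) \<partial>M) * tail G x)"
proof -
  let ?E = "\<integral>\<^sup>+\<omega>. renewal_mean M Z (real (\<tau> \<omega>)) \<partial>M"
  note fin = count_finite[OF small]
  note pos = consistently_varying_pos[OF G_cv]
  define p where "p n = prob {\<omega> \<in> space M. claim_number \<omega> = n}" for n
  have count_eq: "AE \<omega> in M. renewal_count Z (real (\<tau> \<omega>)) \<omega> = of_nat (claim_number \<omega>)"
    using fin by eventually_elim (rule renewal_count_eq_claim_number)
  have E: "?E = (\<integral>\<^sup>+\<omega>. of_nat (claim_number \<omega>) \<partial>M)"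
    unfolding renewal_mean_at_\<tau> by (rule nn_integral_cong_AE[OF count_eq])
  have small': "(\<lambda>x. prob {\<omega> \<in> space M. real (claim_number \<omega>) > x}) \<in> o[at_top](tail G)"
  proof (rule landau_o.small.in_cong[THEN iffD1, OF _ small])
    show "\<forall>\<^sub>F x in at_top. prob {\<omega> \<in> space M. renewal_count Z (real (\<tau> \<omega>)) \<omega> > ennreal x}
        = prob {\<omega> \<in> space M. real (claim_number \<omega>) > x}"
      using eventually_ge_at_top[of 0]
    proof eventually_elim
      case (elim x)
      show ?case
      proof (rule finite_measure_eq_AE)
        show "AE \<omega> in M. (\<omega> \<in> {\<omega> \<in> space M. renewal_count Z (real (\<tau> \<omega>)) \<omega> > ennreal x})
            = (\<omega> \<in> {\<omega> \<in> space M. real (claim_number \<omega>) > x})"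
          using count_eq by eventually_elim (use elim in \<open>auto simp: ennreal_of_nat_eq_real_of_nat ennreal_less_iff\<close>)
      qed measurable
    qed
  qed
  have finE: "(\<integral>\<^sup>+\<omega>. of_nat (claim_number \<omega>) \<partial>M) < \<infinity>"
    by (rule index_mean_finite[OF claim_number_measurable small'])
  then show "?E < \<infinity>" unfolding E .
  note summ = nn_integral_nat_index(1)[OF claim_number_measurable finE]
  define m where "m = (\<Sum>n. real n * p n)"
  have "0 \<le> m" unfolding m_def p_def by (intro suminf_nonneg summ) auto
  then have Em: "enn2real ?E = m"
    unfolding E nn_integral_nat_index(2)[OF claim_number_measurable finE] m_def p_def by simp
  have Ysets: "space (gen_algebra M Y) = space M" by simp
  have [measurable]: "\<And>i. i \<ge> 1 \<Longrightarrow> Y i \<in> borel_measurable (gen_algebra M Y)"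
    by (rule gen_algebra_component)
  have "{\<omega> \<in> space (gen_algebra M Y). claim_sum n \<omega> > x} \<in> sets (gen_algebra M Y)" for n x
    unfolding claim_sum_def by measurable
  then have Q1: "{\<omega> \<in> space M. claim_sum n \<omega> > x} \<in> sets (gen_algebra M Y)" for n x
    unfolding Ysets .
  have "{\<omega> \<in> space (gen_algebra M Y). \<exists>i\<in>{1..n}. Y i \<omega> > x} \<in> sets (gen_algebra M Y)" for n x
    by measurable
  then have Q2: "{\<omega> \<in> space M. \<exists>i\<in>{1..n}. Y i \<omega> > x} \<in> sets (gen_algebra M Y)" for n x
    unfolding Ysets .
  have lim: "((\<lambda>x. ruin_prob M Y Z c \<tau> x / tail G x) \<longlongrightarrow> m) at_top"
  proof (rule order_tendstoI)
    fix r assume r: "r < m"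
    have "\<forall>\<^sub>F x in at_top. r < prob {\<omega> \<in> space M. claim_sum (claim_number \<omega>) \<omega> - income (claim_number \<omega>) \<omega> > x} / tail G x"
      by (rule random_sum_tail_lower[OF claim_number_measurable income_measurable
            indep_claim_number(1)[OF Q2, unfolded conj_assoc] summ r[unfolded m_def p_def]])
    then show "\<forall>\<^sub>F x in at_top. r < ruin_prob M Y Z c \<tau> x / tail G x"
      by eventually_elim
        (erule less_le_trans, intro divide_right_mono ruin_prob_ge[OF fin] less_imp_le[OF pos])
  next
    fix r assume r: "m < r"
    have "\<forall>\<^sub>F x in at_top. prob {\<omega> \<in> space M. claim_sum (claim_number \<omega>) \<omega> > x} / tail G x < r"
      by (rule random_sum_tail_upper[OF claim_number_measurable indep_claim_number(2)[OF Q1]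
            small' summ r[unfolded m_def p_def]])
    then show "\<forall>\<^sub>F x in at_top. ruin_prob M Y Z c \<tau> x / tail G x < r"
      by eventually_elim
        (erule le_less_trans[rotated], intro divide_right_mono ruin_prob_le[OF fin] less_imp_le[OF pos])
  qed
  show "ruin_prob M Y Z c \<tau> \<sim>[at_top] (\<lambda>x. enn2real ?E * tail G x)"
  proof (cases "m = 0")
    case False
    then show ?thesis unfolding Em using lim by (intro asymp_equivI'_const)
  next
    case True
    have "(\<integral>\<^sup>+\<omega>. of_nat (claim_number \<omega>) \<partial>M) = 0"
      using True unfolding nn_integral_nat_index(2)[OF claim_number_measurable finE] by (simp add: m_def p_def)
    then have "AE \<omega> in M. claim_number \<omega> = 0"
      by (subst (asm) nn_integral_0_iff_AE) auto
    then have "AE \<omega> in M. \<not> claim_sum (claim_number \<omega>) \<omega> > x" if "x \<ge> 0" for x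
      by eventually_elim (use that in \<open>simp add: claim_sum_def\<close>)
    then have "prob {\<omega> \<in> space M. claim_sum (claim_number \<omega>) \<omega> > x} = 0" if "x \<ge> 0" for x
      using that by (subst prob_eq_0) auto
    then have zero: "ruin_prob M Y Z c \<tau> x = 0" if "x \<ge> 0" for x
      using ruin_prob_le[OF fin, of x] that by (simp add: ruin_prob_def measure_le_0_iff)
    have "\<forall>\<^sub>F x in at_top. ruin_prob M Y Z c \<tau> x = enn2real ?E * tail G x"
      using eventually_ge_at_top[of 0] by eventually_elim (simp add: Em True zero)
    then show ?thesis by (rule asymp_equiv_refl_ev)
  qed
qed

end

theorem proposition4p2:
  fixes M :: "'a measure" and G H :: "real measure"
    and Y Z :: "nat \<Rightarrow> 'a \<Rightarrow> real" and c :: real and \<tau> :: "'a \<Rightarrow> nat"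
  assumes "prob_space M"
    and "\<And>i. i \<ge> 1 \<Longrightarrow> Y i \<in> borel_measurable M"
    and "\<And>i. i \<ge> 1 \<Longrightarrow> distr M borel (Y i) = G"
    and "ENOD M Y"
    and "measure G {0..} = 1"
    and "consistently_varying G"
    and "integrable G (\<lambda>y. y)"
    and "\<And>i. i \<ge> 1 \<Longrightarrow> Z i \<in> borel_measurable M"
    and "\<And>i. i \<ge> 1 \<Longrightarrow> distr M borel (Z i) = H"
    and "ENOD M Z"
    and "measure H {0..} = 1"
    and "integrable H (\<lambda>z. z)"
    and "indep_rv M seq_space (seq_rv Y) seq_space (seq_rv Z)"
    and "c > 0"
    and "(\<integral>y. y \<partial>G) < c * (\<integral>z. z \<partial>H)"
    and "Inf {t :: real. 0 \<le> t \<and> renewal_mean M Z t > 0} = 0"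
    and "\<tau> \<in> measurable M (count_space UNIV)"
    and "indep_rv M (count_space UNIV) \<tau>
           (seq_space \<Otimes>\<^sub>M seq_space) (\<lambda>\<omega>. (seq_rv Y \<omega>, seq_rv Z \<omega>))"
    and "(\<lambda>x :: real. measure M {\<omega> \<in> space M. renewal_count Z (real (\<tau> \<omega>)) \<omega> > ennreal x})
           \<in> o[at_top](tail G)"
  shows "(\<integral>\<^sup>+ \<omega>. renewal_mean M Z (real (\<tau> \<omega>)) \<partial>M) < \<infinity> \<and>
    ruin_prob M Y Z c \<tau> \<sim>[at_top]
      (\<lambda>x. enn2real (\<integral>\<^sup>+ \<omega>. renewal_mean M Z (real (\<tau> \<omega>)) \<partial>M) * tail G x)"
proof -
  interpret prob_space M by fact
  interpret enod_claims M Y G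
    by (unfold_locales; fact assms)
  interpret ruin_model M Y G Z c \<tau>
  proof unfold_locales
    show "AE \<omega> in M. \<forall>i\<ge>1. 0 \<le> Z i \<omega>"
      by (rule AE_nonneg_of_distr[OF assms(8,9,11)])
  qed (fact assms)+
  show ?thesis
    using ruin_prob_asymptotics[OF assms(19)] by blast
qed

end
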